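(* Let $d\in\{1,2,3\}$, let $\Omega=[-\pi,\pi]^d$ be the $2\pi$-periodic torus, let $\nu>0$, $\tau>0$, $f(u)=u^3-u$, $F(u)=\frac14(u^2-1)^2$, and $$\mathcal E(u)=\int_\Omega\Bigl(\frac12\nu|\nabla u|^2+F(u)\Bigr)dx.$$ Let $u^0:\Omega\to\mathbb R$ be a bounded (measurable) function with mean zero, and let $(u^n)_{n\ge0}$ be generated from $u^0$ by the semi-discrete scheme $$\frac{u^{n+1}-u^n}{\tau} = - \nu \Delta^2 u^{n+1} + A \Delta (u^{n+1}-u^n) +\Delta( f(u^n) ), \qquad n\ge 0.$$ Assume $$A\ge A_{cr}=1+2\sqrt{1+\frac43\cdot\frac{\nu}{\tau}}$$ and $\|u^0\|_\infty\le\sqrt{\frac{A+1}3}$. Then for all $n\ge0$, $$\mathcal E(u^{n+1})+\frac A2\|u^{n+1}-u^n\|_2^2+\tau\bigl\|\nabla\bigl(-\nu\Delta u^{n+1}+A(u^{n+1}-u^n)+f(u^n)\bigr)\bigr\|_2^2\le\mathcal E(u^n).$$ In particular, $\mathcal E(u^{n+1})\le\mathcal E(u^n)$ for all $n\ge0$.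
   Context: Functions are real-valued on the $2\pi$-periodic torus $\Omega$; $\Delta$ is the Laplacian on the torus, and the scheme is understood in the sense of periodic distributions (given $u^n$, the function $u^{n+1}$ is the unique solution of the linear elliptic equation $(1+\nu\tau\Delta^2-A\tau\Delta)u^{n+1}=u^n-A\tau\Delta u^n+\tau\Delta(f(u^n))$). $\|\cdot\|_\infty$ and $\|\cdot\|_2$ are the $L^\infty(\Omega)$ and $L^2(\Omega)$ norms. The energy $\mathcal E(u)$ is taken to be $+\infty$ if $u\notin H^1(\Omega)$. *)

theory Defs
  imports "HOL-Analysis.Analysis" "HOL-Probability.Essential_Supremum"
begin

text \<open>
  Functions on the torus are functions on \<open>real ^ 'd\<close> that are \<open>2 * pi\<close>-periodic in every
  coordinate; measure-theoretic notions refer to the fundamental cell.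
\<close>

definition cell :: "(real ^ 'd) set" where
  "cell = cbox (\<chi> i. - pi) (\<chi> i. pi)"

definition periodic :: "(real ^ 'd \<Rightarrow> 'b) \<Rightarrow> bool" where
  "periodic u \<longleftrightarrow> (\<forall>i x. u (x + (2 * pi) *\<^sub>R axis i 1) = u x)"

definition torus_L1 :: "(real ^ 'd \<Rightarrow> real) \<Rightarrow> bool" where
  "torus_L1 u \<longleftrightarrow> periodic u \<and> integrable (lebesgue_on cell) u"

definition Linf_norm :: "(real ^ 'd \<Rightarrow> real) \<Rightarrow> ereal" where
  "Linf_norm u = esssup (lebesgue_on cell) (\<lambda>x. ereal \<bar>u x\<bar>)"

definition L2_norm_sq :: "(real ^ 'd \<Rightarrow> 'b::real_normed_vector) \<Rightarrow> ennreal" where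
  "L2_norm_sq g = (\<integral>\<^sup>+ x. ennreal ((norm (g x))\<^sup>2) \<partial>lebesgue_on cell)"

definition in_L2 :: "(real ^ 'd \<Rightarrow> 'b::real_normed_vector) \<Rightarrow> bool" where
  "in_L2 g \<longleftrightarrow> g \<in> borel_measurable (lebesgue_on cell) \<and> L2_norm_sq g < \<infinity>"

definition partial_deriv :: "'d::finite \<Rightarrow> (real ^ 'd \<Rightarrow> real) \<Rightarrow> real ^ 'd \<Rightarrow> real" where
  "partial_deriv i \<phi> x = frechet_derivative \<phi> (at x) (axis i 1)"

text \<open>
  Smoothness: every iterated partial derivative is (totally) differentiable everywhere; the
  continuity of all these derivatives is then automatic.
\<close>

definition test_fun :: "(real ^ 'd \<Rightarrow> real) \<Rightarrow> bool" where
  "test_fun \<phi> \<longleftrightarrow> periodic \<phi> \<and> (\<forall>is x. foldr partial_deriv is \<phi> differentiable at x)"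

text \<open>
  A periodic distribution is represented by its action on test functions; only its values on
  functions satisfying \<open>test_fun\<close> are ever compared.
\<close>

type_synonym 'd distribution = "(real ^ 'd \<Rightarrow> real) \<Rightarrow> real"

definition regular :: "(real ^ 'd \<Rightarrow> real) \<Rightarrow> 'd distribution" where
  "regular u \<phi> = (LINT x|lebesgue_on cell. u x * \<phi> x)"

definition dist_deriv :: "'d::finite \<Rightarrow> 'd distribution \<Rightarrow> 'd distribution" where
  "dist_deriv i T \<phi> = - T (partial_deriv i \<phi>)"

definition laplacian :: "'d::finite distribution \<Rightarrow> 'd distribution" where
  "laplacian T \<phi> = (\<Sum>i\<in>UNIV. dist_deriv i (dist_deriv i T) \<phi>)"

definition has_L2_gradient :: "'d::finite distribution \<Rightarrow> (real ^ 'd \<Rightarrow> real ^ 'd) \<Rightarrow> bool" where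
  "has_L2_gradient T g \<longleftrightarrow>
     in_L2 g \<and> (\<forall>\<phi>. test_fun \<phi> \<longrightarrow> (\<forall>i. dist_deriv i T \<phi> = regular (\<lambda>x. g x $ i) \<phi>))"

text \<open>An arbitrary representative of the gradient, which is unique up to null sets of \<open>cell\<close>.\<close>

definition gradient :: "'d::finite distribution \<Rightarrow> real ^ 'd \<Rightarrow> real ^ 'd" where
  "gradient T = (SOME g. has_L2_gradient T g)"

definition gradient_norm_sq :: "'d::finite distribution \<Rightarrow> ennreal" where
  "gradient_norm_sq T = (if \<exists>g. has_L2_gradient T g then L2_norm_sq (gradient T) else \<infinity>)"

definition in_H1 :: "(real ^ 'd \<Rightarrow> real) \<Rightarrow> bool" where
  "in_H1 u \<longleftrightarrow> in_L2 u \<and> (\<exists>g. has_L2_gradient (regular u) g)"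

definition f_pot :: "real \<Rightarrow> real" where
  "f_pot s = s ^ 3 - s"

definition F_pot :: "real \<Rightarrow> real" where
  "F_pot s = 1 / 4 * (s\<^sup>2 - 1)\<^sup>2"

definition energy :: "real \<Rightarrow> (real ^ 'd \<Rightarrow> real) \<Rightarrow> ennreal" where
  "energy \<nu> u =
     (if in_H1 u
      then \<integral>\<^sup>+ x. ennreal (1 / 2 * \<nu> * (norm (gradient (regular u) x))\<^sup>2 + F_pot (u x))
             \<partial>lebesgue_on cell
      else \<infinity>)"

text \<open>
  One step of the scheme from \<open>v\<close> to \<open>w\<close>, as an identity of periodic distributions. The
  integrability conditions are what makes \<open>v\<close>, \<open>w\<close> and \<open>f_pot \<circ> v\<close> periodic distributions.
\<close>

definition scheme_step ::
  "real \<Rightarrow> real \<Rightarrow> real \<Rightarrow> (real ^ 'd::finite \<Rightarrow> real) \<Rightarrow> (real ^ 'd \<Rightarrow> real) \<Rightarrow> bool" where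
  "scheme_step \<nu> \<tau> A v w \<longleftrightarrow>
     torus_L1 v \<and> torus_L1 (\<lambda>x. f_pot (v x)) \<and> torus_L1 w \<and>
     (\<forall>\<phi>. test_fun \<phi> \<longrightarrow>
        regular (\<lambda>x. (w x - v x) / \<tau>) \<phi> =
          - \<nu> * laplacian (laplacian (regular w)) \<phi>
          + A * laplacian (regular (\<lambda>x. w x - v x)) \<phi>
          + laplacian (regular (\<lambda>x. f_pot (v x))) \<phi>)"

definition chem_potential ::
  "real \<Rightarrow> real \<Rightarrow> (real ^ 'd::finite \<Rightarrow> real) \<Rightarrow> (real ^ 'd \<Rightarrow> real) \<Rightarrow> 'd distribution" where
  "chem_potential \<nu> A v w \<phi> =
     - \<nu> * laplacian (regular w) \<phi>
     + A * regular (\<lambda>x. w x - v x) \<phi>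
     + regular (\<lambda>x. f_pot (v x)) \<phi>"

end

theory Submission imports Defs begin

text \<open>
  The functions \<open>cos (k \<bullet> x) + sin (k \<bullet> x)\<close>, \<open>k\<close> an integer vector, are real, orthogonal and
  complete, and the scheme is diagonal in them. With \<open>l = |k|\<^sup>2\<close> the symbol
  \<open>1 + A \<tau> l + \<nu> \<tau> l\<^sup>2\<close> factors as \<open>(1 + a l) (1 + b l)\<close> with \<open>a, b > 0\<close>. Setting
  \<open>g s = (A + 1) s - s\<^sup>3\<close> and \<open>c = \<tau> / a\<close>, a step from \<open>v\<close> to \<open>w\<close> reads
  \<open>w = (1 - b \<Delta>)\<^sup>-\<^sup>1 ((1 - a \<Delta>)\<^sup>-\<^sup>1 (v - c g(v)) + c g(v))\<close>. The resolvents are positive and fix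
  constants, and the lower bound on \<open>A\<close> amounts to \<open>c (A + 1) \<le> 4 / 3\<close>, which makes both \<open>g s\<close> and
  \<open>s - c g s\<close> maximal on \<open>[-M, M]\<close> at \<open>s = M\<close>, where \<open>M = sqrt ((A + 1) / 3)\<close>. Hence
  \<open>|v| \<le> M\<close> implies \<open>|w| \<le> M\<close>. The argument is run by duality: \<open>w\<close> is tested against
  nonnegative trigonometric polynomials, on which the resolvent acts explicitly.

  Given this bound, testing the scheme with the chemical potential (frequency by frequency, then
  summing by Parseval) controls the quadratic terms, and Taylor's formula with
  \<open>F'' \<le> 3 M\<^sup>2 - 1 = A\<close> on \<open>[-M, M]\<close> controls the potential.
\<close>

section \<open>Orthonormal families of square integrable functions\<close>

definition square_integrable :: "'a measure \<Rightarrow> ('a \<Rightarrow> real) \<Rightarrow> bool" where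
  "square_integrable M f \<longleftrightarrow> f \<in> borel_measurable M \<and> integrable M (\<lambda>x. (f x)\<^sup>2)"

lemma square_integrable_mult:
  assumes "square_integrable M f" "square_integrable M g"
  shows "integrable M (\<lambda>x. f x * g x)"
proof (rule Bochner_Integration.integrable_bound)
  show "integrable M (\<lambda>x. (f x)\<^sup>2 + (g x)\<^sup>2)"
    using assms by (auto simp: square_integrable_def)
  show "(\<lambda>x. f x * g x) \<in> borel_measurable M"
    using assms by (auto simp: square_integrable_def)
  have "\<bar>a * b\<bar> \<le> a\<^sup>2 + b\<^sup>2" for a b :: real
    using sum_squares_bound[of "\<bar>a\<bar>" "\<bar>b\<bar>"] abs_ge_zero[of "a * b"]
    unfolding abs_mult power2_abs by linarith
  then show "AE x in M. norm (f x * g x) \<le> norm ((f x)\<^sup>2 + (g x)\<^sup>2)"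
    by auto
qed

lemma square_integrable_cmult:
  "square_integrable M f \<Longrightarrow> square_integrable M (\<lambda>x. c * f x)"
  by (auto simp: square_integrable_def power_mult_distrib)

lemma square_integrable_add:
  assumes "square_integrable M f" "square_integrable M g"
  shows "square_integrable M (\<lambda>x. f x + g x)"
  using assms square_integrable_mult[OF assms]
  by (auto simp: square_integrable_def power2_sum mult.assoc)

lemma square_integrable_diff:
  assumes "square_integrable M f" "square_integrable M g"
  shows "square_integrable M (\<lambda>x. f x - g x)"
  using square_integrable_add[OF assms(1) square_integrable_cmult[OF assms(2), of "-1"]] by simp

lemma square_integrable_sum:
  assumes "\<And>k. k \<in> K \<Longrightarrow> square_integrable M (f k)"
  shows "square_integrable M (\<lambda>x. \<Sum>k\<in>K. f k x)"
  using assms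
proof (induction K rule: infinite_finite_induct)
  case (insert k K)
  then show ?case by (simp add: square_integrable_add)
qed (auto simp: square_integrable_def)

lemma (in finite_measure) square_integrable_bounded:
  assumes "f \<in> borel_measurable M" "AE x in M. \<bar>f x\<bar> \<le> B"
  shows "square_integrable M f"
  unfolding square_integrable_def
proof
  show "integrable M (\<lambda>x. (f x)\<^sup>2)"
  proof (rule integrable_const_bound[where B="B\<^sup>2"])
    show "AE x in M. norm ((f x)\<^sup>2) \<le> B\<^sup>2"
      using assms(2) by eventually_elim (auto simp: abs_le_square_iff[symmetric])
  qed (use assms in auto)
qed (use assms in auto)

lemma (in finite_measure) integrable_if_square_integrable:
  "square_integrable M f \<Longrightarrow> integrable M f"
  using square_integrable_mult[OF _ square_integrable_bounded[of "\<lambda>x. 1" 1]] by simp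

section \<open>Coefficients, orthogonality and Bessel's inequality\<close>

locale orthonormal_family = finite_measure M for M :: "'a measure" +
  fixes e :: "'k \<Rightarrow> 'a \<Rightarrow> real"
  assumes sq_e: "square_integrable M (e k)"
    and orth: "(\<integral>x. e k x * e l x \<partial>M) = (if k = l then 1 else 0)"
begin

definition coef :: "('a \<Rightarrow> real) \<Rightarrow> 'k \<Rightarrow> real" where
  "coef f k = (\<integral>x. f x * e k x \<partial>M)"

lemma coef_add:
  "square_integrable M f \<Longrightarrow> square_integrable M g \<Longrightarrow> coef (\<lambda>x. f x + g x) k = coef f k + coef g k"
  unfolding coef_def
  by (simp add: distrib_right square_integrable_mult sq_e)

lemma coef_cmult: "coef (\<lambda>x. c * f x) k = c * coef f k"
  unfolding coef_def by (simp add: mult.assoc)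

lemma coef_diff:
  "square_integrable M f \<Longrightarrow> square_integrable M g \<Longrightarrow> coef (\<lambda>x. f x - g x) k = coef f k - coef g k"
  unfolding coef_def
  by (simp add: left_diff_distrib square_integrable_mult sq_e)

lemma sq_comb: "square_integrable M (\<lambda>x. \<Sum>k\<in>K. c k * e k x)"
  by (intro square_integrable_sum square_integrable_cmult sq_e)

lemma integral_mult_comb:
  assumes "square_integrable M f"
  shows "(\<integral>x. f x * (\<Sum>k\<in>K. c k * e k x) \<partial>M) = (\<Sum>k\<in>K. c k * coef f k)"
proof -
  have "(\<integral>x. f x * (\<Sum>k\<in>K. c k * e k x) \<partial>M) = (\<integral>x. (\<Sum>k\<in>K. c k * (f x * e k x)) \<partial>M)"
    by (simp add: sum_distrib_left mult_ac)
  also have "\<dots> = (\<Sum>k\<in>K. c k * coef f k)"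
    unfolding coef_def
    by (subst Bochner_Integration.integral_sum) (auto intro!: square_integrable_mult assms sq_e)
  finally show ?thesis .
qed

lemma coef_comb:
  assumes "finite K"
  shows "coef (\<lambda>x. \<Sum>k\<in>K. c k * e k x) l = (if l \<in> K then c l else 0)"
proof -
  have "coef (\<lambda>x. \<Sum>k\<in>K. c k * e k x) l = (\<Sum>k\<in>K. c k * coef (e l) k)"
    using integral_mult_comb[OF sq_e[of l], of c K] by (simp add: coef_def mult.commute)
  also have "\<dots> = (\<Sum>k\<in>K. if l = k then c k else 0)"
    by (intro sum.cong) (auto simp: coef_def orth)
  also have "\<dots> = (if l \<in> K then c l else 0)"
    using assms by simp
  finally show ?thesis .
qed

lemma norm_comb:
  assumes "finite K"
  shows "(\<integral>x. (\<Sum>k\<in>K. c k * e k x)\<^sup>2 \<partial>M) = (\<Sum>k\<in>K. (c k)\<^sup>2)"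
  using integral_mult_comb[OF sq_comb[of c K], of c K] assms
  by (simp add: coef_comb power2_eq_square)

text \<open>Expansion of the square for arbitrary \<open>c\<close>. Bessel's inequality takes
  \<open>c = coef f\<close>; the limit function in the Riesz-Fischer argument gets its norm from
  it.\<close>

lemma norm_diff_comb:
  assumes "square_integrable M f" "finite K"
  shows "(\<integral>x. (f x - (\<Sum>k\<in>K. c k * e k x))\<^sup>2 \<partial>M)
    = (\<integral>x. (f x)\<^sup>2 \<partial>M) - 2 * (\<Sum>k\<in>K. c k * coef f k) + (\<Sum>k\<in>K. (c k)\<^sup>2)"
proof -
  let ?s = "\<lambda>x. \<Sum>k\<in>K. c k * e k x"
  have "(\<integral>x. (f x - ?s x)\<^sup>2 \<partial>M) = (\<integral>x. (f x)\<^sup>2 - 2 * (f x * ?s x) + (?s x)\<^sup>2 \<partial>M)"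
    by (simp add: power2_diff mult.assoc algebra_simps)
  also have "\<dots> = (\<integral>x. (f x)\<^sup>2 \<partial>M) - 2 * (\<integral>x. f x * ?s x \<partial>M) + (\<integral>x. (?s x)\<^sup>2 \<partial>M)"
    using assms(1) sq_comb[of c K] square_integrable_mult[OF assms(1) sq_comb[of c K]]
    by (simp add: square_integrable_def)
  finally show ?thesis
    using assms by (simp add: integral_mult_comb norm_comb)
qed

lemma bessel:
  assumes "square_integrable M f" "finite K"
  shows "(\<Sum>k\<in>K. (coef f k)\<^sup>2) \<le> (\<integral>x. (f x)\<^sup>2 \<partial>M)"
proof -
  have "0 \<le> (\<integral>x. (f x - (\<Sum>k\<in>K. coef f k * e k x))\<^sup>2 \<partial>M)"
    by simp
  then show ?thesis
    unfolding norm_diff_comb[OF assms] by (simp add: power2_eq_square[symmetric])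
qed

section \<open>Square summable coefficients, completeness of L2, Riesz-Fischer\<close>

lemma coef_summable:
  assumes "square_integrable M f"
  shows "(\<lambda>k. (coef f k)\<^sup>2) summable_on UNIV"
  by (rule nonneg_bdd_above_summable_on)
     (auto intro!: bdd_aboveI[where M="\<integral>x. (f x)\<^sup>2 \<partial>M"] bessel assms)

text \<open>Since the measure is finite, an L2 rate of \<open>(1/2) ^ n\<close> makes the L1 norms
  of consecutive differences summable, so the telescoping series converges absolutely almost
  everywhere. Fatou's lemma then carries the Cauchy estimate over to the limit.\<close>

lemma l2_limit:
  fixes s :: "nat \<Rightarrow> 'a \<Rightarrow> real"
  assumes sq: "\<And>n. square_integrable M (s n)"
    and cauchy: "\<And>m n. n \<le> m \<Longrightarrow> (\<integral>x. (s m x - s n x)\<^sup>2 \<partial>M) \<le> (1/4) ^ n"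
  obtains f where "square_integrable M f" "\<And>n. (\<integral>x. (f x - s n x)\<^sup>2 \<partial>M) \<le> (1/4) ^ n"
proof -
  have [measurable]: "s n \<in> borel_measurable M" for n
    using sq by (auto simp: square_integrable_def)
  have sqd: "square_integrable M (\<lambda>x. s m x - s n x)" for m n
    by (intro square_integrable_diff sq)
  have intd: "integrable M (\<lambda>x. \<bar>s (Suc n) x - s n x\<bar>)" for n
    using integrable_if_square_integrable[OF sqd] by simp
  define C where "C = (1 + measure M (space M)) / 2"
  have bound: "(\<integral>x. \<bar>s (Suc n) x - s n x\<bar> \<partial>M) \<le> C * (1/2) ^ n" for n
  proof -
    \<comment> \<open>The weight \<open>2 ^ n\<close> balances the two terms after integration: the
      square contributes at most \<open>2 ^ n * (1/4) ^ n\<close>, the constant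
      \<open>(1/2) ^ n\<close> times the total mass.\<close>
    have amgm: "\<bar>t\<bar> \<le> (2 ^ n * t\<^sup>2 + (1/2) ^ n) / 2" for t :: real
    proof -
      have "0 \<le> (1/2)^n * (2 ^ n * \<bar>t\<bar> - 1)\<^sup>2" by simp
      also have "\<dots> = (1/2)^n * 2^n * 2^n * t\<^sup>2 - 2 * ((1/2)^n * 2^n) * \<bar>t\<bar> + (1/2)^n"
        by (simp add: power2_eq_square algebra_simps)
      also have "(1/2)^n * 2^n = (1::real)"
        by (simp add: power_mult_distrib[symmetric])
      finally show ?thesis by simp
    qed
    have "(\<integral>x. \<bar>s (Suc n) x - s n x\<bar> \<partial>M)
      \<le> (\<integral>x. (2 ^ n * (s (Suc n) x - s n x)\<^sup>2 + (1/2) ^ n) / 2 \<partial>M)"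
      by (rule integral_mono[OF intd]) (use sqd amgm in \<open>auto simp: square_integrable_def\<close>)
    also have "\<dots> = (2 ^ n * (\<integral>x. (s (Suc n) x - s n x)\<^sup>2 \<partial>M) + (1/2) ^ n * measure M (space M)) / 2"
      using sqd[of "Suc n" n] by (simp add: square_integrable_def mult.commute)
    also have "\<dots> \<le> (2 ^ n * (1/4) ^ n + (1/2) ^ n * measure M (space M)) / 2"
      using cauchy[of n "Suc n"] by simp
    also have "(2::real) ^ n * (1/4) ^ n = (1/2) ^ n"
      by (simp add: power_mult_distrib[symmetric])
    finally show ?thesis by (simp add: C_def algebra_simps)
  qed
  have ae: "AE x in M. summable (\<lambda>n. \<bar>s (Suc n) x - s n x\<bar>)"
  proof -
    have "(\<integral>\<^sup>+x. (\<Sum>n. ennreal \<bar>s (Suc n) x - s n x\<bar>) \<partial>M)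
        = (\<Sum>n. \<integral>\<^sup>+x. ennreal \<bar>s (Suc n) x - s n x\<bar> \<partial>M)"
      by (rule nn_integral_suminf) auto
    also have "\<dots> \<le> (\<Sum>n. ennreal (C * (1/2) ^ n))"
      using bound by (intro suminf_le) (auto simp: nn_integral_eq_integral[OF intd] intro!: ennreal_leI)
    also have "\<dots> = ennreal (\<Sum>n. C * (1/2) ^ n)"
      by (rule suminf_ennreal2) (auto simp: C_def intro!: summable_mult)
    also have "\<dots> < \<infinity>" by simp
    finally have fin: "(\<integral>\<^sup>+x. (\<Sum>n. ennreal \<bar>s (Suc n) x - s n x\<bar>) \<partial>M) \<noteq> \<infinity>" by auto
    have "AE x in M. (\<Sum>n. ennreal \<bar>s (Suc n) x - s n x\<bar>) \<noteq> \<infinity>"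
      by (rule nn_integral_PInf_AE[OF _ fin]) auto
    then show ?thesis
      by eventually_elim (rule summable_suminf_not_top, auto)
  qed
  \<comment> \<open>Where the sequence diverges, \<open>lim\<close> has an unspecified value. This
    happens only on a null set, and \<open>f\<close> is measurable all the same.\<close>
  define f where "f x = lim (\<lambda>n. s n x)" for x
  have [measurable]: "f \<in> borel_measurable M"
    unfolding f_def by measurable
  have lims: "AE x in M. (\<lambda>n. s n x) \<longlonglongrightarrow> f x"
    using ae
  proof eventually_elim
    case (elim x)
    then have "summable (\<lambda>n. s (Suc n) x - s n x)"
      by (rule summable_rabs_cancel)
    then have "convergent (\<lambda>n. \<Sum>i<n. s (Suc i) x - s i x)"
      by (simp add: summable_iff_convergent)
    then have "convergent (\<lambda>n. s 0 x + (s n x - s 0 x))"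
      unfolding sum_lessThan_telescope[of "\<lambda>i. s i x"] by (intro convergent_add convergent_const)
    then show ?case
      unfolding f_def by (simp add: convergent_LIMSEQ_iff)
  qed
  have fatou: "(\<integral>\<^sup>+x. ennreal ((f x - s n x)\<^sup>2) \<partial>M) \<le> ennreal ((1/4) ^ n)" for n
  proof -
    have "(\<integral>\<^sup>+x. ennreal ((f x - s n x)\<^sup>2) \<partial>M)
       = (\<integral>\<^sup>+x. liminf (\<lambda>m. ennreal ((s m x - s n x)\<^sup>2)) \<partial>M)"
    proof (rule nn_integral_cong_AE)
      show "AE x in M. ennreal ((f x - s n x)\<^sup>2) = liminf (\<lambda>m. ennreal ((s m x - s n x)\<^sup>2))"
        using lims
      proof eventually_elim
        case (elim x)
        then have "(\<lambda>m. ennreal ((s m x - s n x)\<^sup>2)) \<longlonglongrightarrow> ennreal ((f x - s n x)\<^sup>2)"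
          by (intro tendsto_intros)
        then show ?case by (rule lim_imp_Liminf[OF sequentially_bot, symmetric])
      qed
    qed
    also have "\<dots> \<le> liminf (\<lambda>m. \<integral>\<^sup>+x. ennreal ((s m x - s n x)\<^sup>2) \<partial>M)"
      by (rule nn_integral_liminf) auto
    also have "\<dots> \<le> liminf (\<lambda>m. ennreal ((1/4) ^ n))"
    proof (rule Liminf_mono)
      show "\<forall>\<^sub>F m in sequentially. (\<integral>\<^sup>+x. ennreal ((s m x - s n x)\<^sup>2) \<partial>M) \<le> ennreal ((1/4) ^ n)"
        using eventually_ge_at_top[of n]
      proof eventually_elim
        case (elim m)
        have "(\<integral>\<^sup>+x. ennreal ((s m x - s n x)\<^sup>2) \<partial>M) = ennreal (\<integral>x. (s m x - s n x)\<^sup>2 \<partial>M)"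
          using sqd[of m n] by (intro nn_integral_eq_integral) (auto simp: square_integrable_def)
        also have "\<dots> \<le> ennreal ((1/4) ^ n)"
          using cauchy[OF elim] by (rule ennreal_leI)
        finally show ?case .
      qed
    qed
    also have "\<dots> = ennreal ((1/4) ^ n)"
      by (simp add: Liminf_const)
    finally show ?thesis .
  qed
  have sqfs: "square_integrable M (\<lambda>x. f x - s n x)" for n
    unfolding square_integrable_def
    using fatou[of n] by (auto intro!: integrableI_bounded simp: less_top[symmetric] top_unique)
  show ?thesis
  proof (rule that)
    show "square_integrable M f"
      using square_integrable_add[OF sqfs[of 0] sq[of 0]] by simp
    show "(\<integral>x. (f x - s n x)\<^sup>2 \<partial>M) \<le> (1/4) ^ n" for n
      using fatou[of n] sqfs[of n]
      by (subst (asm) nn_integral_eq_integral) (auto simp: square_integrable_def)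
  qed
qed

lemma coef_le_norm:
  assumes "square_integrable M f"
  shows "(coef f k)\<^sup>2 \<le> (\<integral>x. (f x)\<^sup>2 \<partial>M)"
  using bessel[OF assms, of "{k}"] by simp

text \<open>The function is the L2 limit of partial sums over finite index sets that miss at most
  \<open>(1/4) ^ n\<close> of the total. Taking unions nests these sets, so a difference of partial
  sums is again a combination over a finite set and its norm is part of the tail.\<close>

lemma riesz_fischer:
  assumes "(\<lambda>k. (c k)\<^sup>2) summable_on UNIV"
  obtains f where "square_integrable M f" "\<And>k. coef f k = c k"
    "((\<lambda>k. (c k)\<^sup>2) has_sum (\<integral>x. (f x)\<^sup>2 \<partial>M)) UNIV"
proof -
  define S where "S = (\<Sum>\<^sub>\<infinity>k. (c k)\<^sup>2)"
  have hs: "((\<lambda>k. (c k)\<^sup>2) has_sum S) UNIV"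
    using assms unfolding S_def by (rule has_sum_infsum)
  have "\<exists>F. finite F \<and> S - (\<Sum>k\<in>F. (c k)\<^sup>2) \<le> (1/4) ^ n" for n
  proof -
    have "\<forall>\<^sub>F F in finite_subsets_at_top UNIV. dist (\<Sum>k\<in>F. (c k)\<^sup>2) S < (1/4) ^ n"
      using hs unfolding has_sum_def by (rule tendstoD) simp
    then have "\<forall>\<^sub>F F in finite_subsets_at_top UNIV. finite F \<and> S - (\<Sum>k\<in>F. (c k)\<^sup>2) \<le> (1/4) ^ n"
      using eventually_finite_subsets_at_top_weakI[of UNIV finite]
      by (auto simp: dist_real_def elim!: eventually_elim2)
    then show ?thesis
      using eventually_happens'[OF finite_subsets_at_top_neq_bot] by blast
  qed
  then obtain F0 where F0: "\<And>n. finite (F0 n)" "\<And>n. S - (\<Sum>k\<in>F0 n. (c k)\<^sup>2) \<le> (1/4) ^ n"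
    by metis
  define F where "F n = (\<Union>m\<le>n. F0 m)" for n
  have finF: "finite (F n)" for n
    unfolding F_def using F0 by auto
  have monoF: "F n \<subseteq> F m" if "n \<le> m" for n m
    unfolding F_def using that by fastforce
  have sum_le: "(\<Sum>k\<in>G. (c k)\<^sup>2) \<le> S" if "finite G" for G
    using that hs by (intro has_sum_mono_neutral[OF has_sum_finite hs]) auto
  have tail: "S - (\<Sum>k\<in>F n. (c k)\<^sup>2) \<le> (1/4) ^ n" for n
  proof -
    have "(\<Sum>k\<in>F0 n. (c k)\<^sup>2) \<le> (\<Sum>k\<in>F n. (c k)\<^sup>2)"
      by (rule sum_mono2[OF finF]) (auto simp: F_def)
    then show ?thesis using F0(2)[of n] by simp
  qed
  define s where "s n x = (\<Sum>k\<in>F n. c k * e k x)" for n x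
  have sqs: "square_integrable M (s n)" for n
    unfolding s_def by (rule sq_comb)
  have coefs: "coef (s n) k = (if k \<in> F n then c k else 0)" for n k
    unfolding s_def using finF by (rule coef_comb)
  have cauchy: "(\<integral>x. (s m x - s n x)\<^sup>2 \<partial>M) \<le> (1/4) ^ n" if "n \<le> m" for n m
  proof -
    have "s m x - s n x = (\<Sum>k\<in>F m - F n. c k * e k x)" for x
      unfolding s_def using monoF[OF that] finF by (simp add: sum_diff)
    then have "(\<integral>x. (s m x - s n x)\<^sup>2 \<partial>M) = (\<Sum>k\<in>F m - F n. (c k)\<^sup>2)"
      using finF by (simp add: norm_comb)
    also have "\<dots> = (\<Sum>k\<in>F m. (c k)\<^sup>2) - (\<Sum>k\<in>F n. (c k)\<^sup>2)"
      using monoF[OF that] finF by (simp add: sum_diff)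
    also have "\<dots> \<le> S - (\<Sum>k\<in>F n. (c k)\<^sup>2)"
      using sum_le[OF finF] by simp
    finally show ?thesis using tail[of n] by linarith
  qed
  obtain f where f: "square_integrable M f" "\<And>n. (\<integral>x. (f x - s n x)\<^sup>2 \<partial>M) \<le> (1/4) ^ n"
    using l2_limit[OF sqs cauchy] by blast
  have lim0: "(\<lambda>n. (1/4::real) ^ n) \<longlonglongrightarrow> 0"
    by (rule LIMSEQ_power_zero) simp
  have err0: "(\<lambda>n. \<integral>x. (f x - s n x)\<^sup>2 \<partial>M) \<longlonglongrightarrow> 0"
    by (rule tendsto_sandwich[OF _ _ tendsto_const lim0]) (auto simp: f)
  have coeff: "coef f k = c k" for k
  proof -
    have "(\<lambda>n. (coef f k - coef (s n) k)\<^sup>2) \<longlonglongrightarrow> 0"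
    proof (rule tendsto_sandwich[OF _ _ tendsto_const err0])
      show "\<forall>\<^sub>F n in sequentially. (coef f k - coef (s n) k)\<^sup>2 \<le> (\<integral>x. (f x - s n x)\<^sup>2 \<partial>M)"
        using coef_le_norm[OF square_integrable_diff[OF f(1) sqs]]
        by (simp add: coef_diff f(1) sqs)
    qed simp
    then have "(\<lambda>n. sqrt ((coef f k - coef (s n) k)\<^sup>2)) \<longlonglongrightarrow> sqrt 0"
      by (rule tendsto_real_sqrt)
    then have lim1: "(\<lambda>n. coef f k - coef (s n) k) \<longlonglongrightarrow> 0"
      by (simp add: tendsto_rabs_zero_iff)
    \<comment> \<open>If \<open>k\<close> lies outside \<open>F n\<close>, then
      \<open>(c k)\<^sup>2\<close> is part of the tail left by \<open>F n\<close>, hence at most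
      \<open>(1/4) ^ n\<close>. This includes an index that enters no \<open>F n\<close>: there
      \<open>c k = 0\<close>.\<close>
    have ge: "(\<lambda>n. if k \<in> F n then 0 else (c k)\<^sup>2) \<longlonglongrightarrow> 0"
    proof (rule tendsto_sandwich[OF _ _ tendsto_const lim0])
      show "\<forall>\<^sub>F n in sequentially. (if k \<in> F n then 0 else (c k)\<^sup>2) \<le> (1/4) ^ n"
      proof (rule always_eventually, rule allI)
        fix n
        have "(c k)\<^sup>2 + (\<Sum>k\<in>F n. (c k)\<^sup>2) \<le> S" if "k \<notin> F n"
          using sum_le[of "insert k (F n)"] that finF[of n] by simp
        then show "(if k \<in> F n then 0 else (c k)\<^sup>2) \<le> (1/4) ^ n"
          using tail[of n] by auto
      qed
    qed auto
    have "(\<lambda>n. (c k - coef (s n) k)\<^sup>2) \<longlonglongrightarrow> 0"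
      by (rule Lim_transform_eventually[OF ge]) (auto simp: coefs)
    then have "(\<lambda>n. sqrt ((c k - coef (s n) k)\<^sup>2)) \<longlonglongrightarrow> sqrt 0"
      by (rule tendsto_real_sqrt)
    then have lim2: "(\<lambda>n. c k - coef (s n) k) \<longlonglongrightarrow> 0"
      by (simp add: tendsto_rabs_zero_iff)
    from tendsto_diff[OF lim1 lim2] have "(\<lambda>n. coef f k - c k) \<longlonglongrightarrow> 0"
      by simp
    then show ?thesis by (simp add: LIMSEQ_const_iff)
  qed
  have norm: "(\<integral>x. (f x - s n x)\<^sup>2 \<partial>M) = (\<integral>x. (f x)\<^sup>2 \<partial>M) - (\<Sum>k\<in>F n. (c k)\<^sup>2)" for n
    using norm_diff_comb[OF f(1) finF, of c] by (simp add: s_def coeff power2_eq_square)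
  have "(\<lambda>n. S - (\<Sum>k\<in>F n. (c k)\<^sup>2)) \<longlonglongrightarrow> 0"
    using sum_le[OF finF] tail
    by (intro tendsto_sandwich[OF _ _ tendsto_const lim0]) auto
  from tendsto_diff[OF err0 this] have "(\<lambda>n. (\<integral>x. (f x)\<^sup>2 \<partial>M) - S) \<longlonglongrightarrow> 0"
    by (simp add: norm)
  then have "(\<integral>x. (f x)\<^sup>2 \<partial>M) = S"
    by (simp add: LIMSEQ_const_iff)
  with hs f(1) coeff show ?thesis
    by (intro that[of f]) auto
qed

end

section \<open>Parseval's identity for complete families\<close>

locale orthonormal_basis = orthonormal_family +
  assumes complete: "square_integrable M f \<Longrightarrow> (\<And>k. coef f k = 0) \<Longrightarrow> AE x in M. f x = 0"
begin

text \<open>Riesz-Fischer yields a function with the coefficients of \<open>f\<close> whose squared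
  norm is their square sum; by completeness it agrees with \<open>f\<close> almost
  everywhere.\<close>

lemma parseval_norm:
  assumes "square_integrable M f"
  shows "((\<lambda>k. (coef f k)\<^sup>2) has_sum (\<integral>x. (f x)\<^sup>2 \<partial>M)) UNIV"
proof -
  obtain g where g: "square_integrable M g" "\<And>k. coef g k = coef f k"
    "((\<lambda>k. (coef f k)\<^sup>2) has_sum (\<integral>x. (g x)\<^sup>2 \<partial>M)) UNIV"
    using riesz_fischer[OF coef_summable[OF assms]] by blast
  have ae: "AE x in M. f x - g x = 0"
    by (rule complete) (auto simp: square_integrable_diff assms g coef_diff)
  have "(\<integral>x. (f x)\<^sup>2 \<partial>M) = (\<integral>x. (g x)\<^sup>2 \<partial>M)"
    using assms g(1) ae by (intro integral_cong_AE) (auto simp: square_integrable_def)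
  then show ?thesis using g by simp
qed

text \<open>Polarization of the norm identity.\<close>

lemma parseval:
  assumes "square_integrable M f" "square_integrable M g"
  shows "((\<lambda>k. coef f k * coef g k) has_sum (\<integral>x. f x * g x \<partial>M)) UNIV"
proof -
  have ip: "integrable M (\<lambda>x. (f x)\<^sup>2)" "integrable M (\<lambda>x. (g x)\<^sup>2)" "integrable M (\<lambda>x. f x * g x)"
    using assms by (auto simp: square_integrable_def square_integrable_mult)
  have p: "((\<lambda>k. (coef f k + coef g k)\<^sup>2) has_sum (\<integral>x. (f x + g x)\<^sup>2 \<partial>M)) UNIV"
    using parseval_norm[OF square_integrable_add[OF assms]] by (simp add: coef_add assms)
  have "((\<lambda>k. 1/2 * ((coef f k + coef g k)\<^sup>2 - (coef f k)\<^sup>2 - (coef g k)\<^sup>2)) has_sum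
      1/2 * ((\<integral>x. (f x + g x)\<^sup>2 \<partial>M) - (\<integral>x. (f x)\<^sup>2 \<partial>M) - (\<integral>x. (g x)\<^sup>2 \<partial>M))) UNIV"
    unfolding diff_conv_add_uminus
    by (intro has_sum_cmult_right has_sum_add has_sum_uminusI p parseval_norm assms)
  also have "(\<integral>x. (f x + g x)\<^sup>2 \<partial>M) = (\<integral>x. (f x)\<^sup>2 + (g x)\<^sup>2 + 2 * (f x * g x) \<partial>M)"
    by (simp add: power2_sum mult.assoc)
  also have "\<dots> = (\<integral>x. (f x)\<^sup>2 \<partial>M) + (\<integral>x. (g x)\<^sup>2 \<partial>M) + 2 * (\<integral>x. f x * g x \<partial>M)"
    using ip by simp
  finally show ?thesis
    by (simp add: power2_sum algebra_simps)
qed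

end

section \<open>The Hartley basis on the torus\<close>

lemma cell_measurable [simp, measurable]: "cell \<in> sets lebesgue"
  by (simp add: cell_def)

lemma finite_measure_cell: "finite_measure (lebesgue_on (cell :: (real ^ 'd) set))"
proof
  show "emeasure (lebesgue_on (cell :: (real ^ 'd) set)) (space (lebesgue_on cell)) \<noteq> \<infinity>"
    using emeasure_lborel_cbox_finite[of "\<chi> i. - pi" "(\<chi> i. pi) :: real ^ 'd"]
    by (simp add: emeasure_restrict_space cell_def less_top)
qed

lemma mem_cell: "x \<in> cell \<longleftrightarrow> (\<forall>i. - pi \<le> x $ i \<and> x $ i \<le> pi)"
  by (auto simp: cell_def mem_box_cart)

lemma measure_cell_pos: "measure lebesgue (cell :: (real ^ 'd) set) > 0"
proof -
  have "measure lborel (cbox (\<chi> i. - pi) ((\<chi> i. pi) :: real ^ 'd)) > 0"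
    unfolding content_pos_lt_eq by (auto simp: Basis_vec_def inner_axis)
  then show ?thesis by (simp add: cell_def)
qed

lemma continuous_integrable_cell:
  fixes \<phi> :: "real ^ 'd \<Rightarrow> real"
  assumes "continuous_on UNIV \<phi>"
  shows "integrable (lebesgue_on cell) \<phi>"
  unfolding cell_def
  by (rule continuous_imp_integrable) (rule continuous_on_subset[OF assms], simp)

lemma continuous_square_integrable_cell:
  fixes \<phi> :: "real ^ 'd \<Rightarrow> real"
  assumes "continuous_on UNIV \<phi>"
  shows "square_integrable (lebesgue_on cell) \<phi>"
  unfolding square_integrable_def
  using assms continuous_integrable_cell[OF assms]
  by (auto intro!: continuous_integrable_cell continuous_intros)

text \<open>The shifted cell arises by cutting the slab of thickness \<open>t\<close> from the lower
  face in direction \<open>j\<close> and attaching its translate by one period to the upper face.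
  Periodicity makes both slabs contribute equally, and \<open>0 \<le> t \<le> 2 * pi\<close> keeps
  all pieces boxes.\<close>

lemma integral_translate:
  fixes \<phi> :: "real ^ 'd \<Rightarrow> real"
  assumes cont: "continuous_on UNIV \<phi>" and per: "periodic \<phi>" and t: "0 \<le> t" "t \<le> 2 * pi"
  shows "integral cell (\<lambda>x. \<phi> (x + t *\<^sub>R axis j 1)) = integral cell \<phi>"
proof -
  define a b e :: "real ^ 'd" where "a = (\<chi> i. - pi)" and "b = (\<chi> i. pi)" and "e = axis j 1"
  define b' where "b' = (\<chi> i. if i = j then - pi + t else pi)"
  have cell: "cell = cbox a b"
    by (simp add: cell_def a_def b_def)
  have eB: "e \<in> Basis"
    by (auto simp: e_def Basis_vec_def)
  have ec: "e $ i = (if i = j then 1 else 0)" for i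
    by (simp add: e_def axis_def)
  have ie: "x \<bullet> e = x $ j" for x :: "real ^ 'd"
    by (simp add: e_def inner_axis)
  have int: "(\<phi> has_integral integral (cbox p q) \<phi>) (cbox p q)" for p q
    using cont by (intro integrable_integral integrable_continuous) (rule continuous_on_subset, auto)
  have box: "x \<in> cbox p q \<longleftrightarrow> (p $ j \<le> x $ j \<and> x $ j \<le> q $ j) \<and> (\<forall>i. i \<noteq> j \<longrightarrow> p $ i \<le> x $ i \<and> x $ i \<le> q $ i)"
    for x p q :: "real ^ 'd"
    unfolding mem_box_cart by metis
  have s1: "cbox a b \<inter> {x. x \<bullet> e \<le> - pi + t} = cbox a b'"
    "cbox a b \<inter> {x. x \<bullet> e \<ge> - pi + t} = cbox (a + t *\<^sub>R e) b"
    using t by (auto simp: set_eq_iff box ie ec a_def b_def b'_def)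
  have s2: "cbox (a + t *\<^sub>R e) (b + t *\<^sub>R e) \<inter> {x. x \<bullet> e \<le> pi} = cbox (a + t *\<^sub>R e) b"
    "cbox (a + t *\<^sub>R e) (b + t *\<^sub>R e) \<inter> {x. x \<bullet> e \<ge> pi} = cbox (a + (2 * pi) *\<^sub>R e) (b' + (2 * pi) *\<^sub>R e)"
    using t by (auto simp: set_eq_iff box ie ec a_def b_def b'_def)
  have i1: "integral (cbox a b) \<phi> = integral (cbox a b') \<phi> + integral (cbox (a + t *\<^sub>R e) b) \<phi>"
    by (rule integral_unique, rule has_integral_split[OF _ _ eB, where c="- pi + t"])
       (simp_all only: s1 int)
  have i2: "integral (cbox (a + t *\<^sub>R e) (b + t *\<^sub>R e)) \<phi> = integral (cbox (a + t *\<^sub>R e) b) \<phi>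
      + integral (cbox (a + (2 * pi) *\<^sub>R e) (b' + (2 * pi) *\<^sub>R e)) \<phi>"
    by (rule integral_unique, rule has_integral_split[OF _ _ eB, where c="pi"])
       (simp_all only: s2 int)
  have i3: "integral (cbox (a + (2 * pi) *\<^sub>R e) (b' + (2 * pi) *\<^sub>R e)) \<phi> = integral (cbox a b') \<phi>"
  proof -
    have "\<phi> \<circ> (+) ((2 * pi) *\<^sub>R e) = \<phi>"
      using per by (auto simp: periodic_def e_def add.commute)
    then show ?thesis
      using integral_shift_cbox_plus[of a b' \<phi> "(2 * pi) *\<^sub>R e"] by simp
  qed
  have "integral (cbox a b) (\<lambda>x. \<phi> (x + t *\<^sub>R e)) = integral (cbox (a + t *\<^sub>R e) (b + t *\<^sub>R e)) \<phi>"
    using integral_shift_cbox_plus[of a b \<phi> "t *\<^sub>R e"] by (simp add: o_def add.commute)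
  with i1 i2 i3 show ?thesis
    by (simp add: cell e_def)
qed

lemma partial_deriv_eq:
  "(\<phi> has_derivative \<phi>') (at x) \<Longrightarrow> partial_deriv i \<phi> x = \<phi>' (axis i 1)"
  unfolding partial_deriv_def by (simp add: frechet_derivative_at[symmetric])

text \<open>The integral of the translates is constant in the shift, while differentiating it under
  the integral sign at shift 0 gives the integral of the partial derivative. Applied to products,
  this is integration by parts without boundary terms.\<close>

lemma integral_partial_deriv:
  fixes \<phi> :: "real ^ 'd \<Rightarrow> real"
  assumes diff: "\<And>x. \<phi> differentiable at x" and per: "periodic \<phi>"
    and cont: "continuous_on UNIV (partial_deriv j \<phi>)"
  shows "(LINT x|lebesgue_on cell. partial_deriv j \<phi> x) = 0"
proof -
  define e :: "real ^ 'd" where "e = axis j 1"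
  have contphi: "continuous_on UNIV \<phi>"
    using diff by (simp add: continuous_at_imp_continuous_on differentiable_imp_continuous_within)
  have der: "((\<lambda>t. \<phi> (x + t *\<^sub>R e)) has_vector_derivative partial_deriv j \<phi> (x + t *\<^sub>R e)) (at t within U)" for x t U
  proof -
    have "(\<phi> has_derivative frechet_derivative \<phi> (at (x + t *\<^sub>R e))) (at (x + t *\<^sub>R e))"
      using diff frechet_derivative_works by blast
    moreover have "((\<lambda>t. x + t *\<^sub>R e) has_derivative (\<lambda>h. h *\<^sub>R e)) (at t within U)"
      by (auto intro!: derivative_eq_intros)
    ultimately have "((\<lambda>t. \<phi> (x + t *\<^sub>R e)) has_derivative
        (\<lambda>h. frechet_derivative \<phi> (at (x + t *\<^sub>R e)) (h *\<^sub>R e))) (at t within U)"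
      by (rule has_derivative_compose[rotated])
    moreover have "frechet_derivative \<phi> (at (x + t *\<^sub>R e)) (h *\<^sub>R e)
      = h *\<^sub>R partial_deriv j \<phi> (x + t *\<^sub>R e)" for h
      using linear_frechet_derivative[OF diff, of "x + t *\<^sub>R e"]
      by (simp add: partial_deriv_def e_def linear_cmul)
    ultimately show ?thesis
      by (simp add: has_vector_derivative_def)
  qed
  \<comment> \<open>The derivative is one-sided, taken within one period, because translation
    invariance was established for those shifts.\<close>
  have "((\<lambda>t. integral cell (\<lambda>x. \<phi> (x + t *\<^sub>R e))) has_vector_derivative
      integral cell (\<lambda>x. partial_deriv j \<phi> (x + 0 *\<^sub>R e))) (at 0 within {0..2 * pi})"
    unfolding cell_def
  proof (rule leibniz_rule_vector_derivative)
    show "(\<lambda>x. \<phi> (x + t *\<^sub>R e)) integrable_on cbox (\<chi> i. - pi) (\<chi> i. pi)" for t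
      by (intro integrable_continuous continuous_on_compose2[OF contphi] continuous_intros) auto
    show "continuous_on ({0..2 * pi} \<times> cbox (\<chi> i. - pi) (\<chi> i. pi))
        (\<lambda>(t, x). partial_deriv j \<phi> (x + t *\<^sub>R e))"
      unfolding case_prod_beta
      by (intro continuous_on_compose2[OF cont] continuous_intros) auto
  qed (auto intro: der)
  moreover have "((\<lambda>t. integral cell (\<lambda>x. \<phi> (x + t *\<^sub>R e))) has_vector_derivative 0) (at 0 within {0..2 * pi})"
    by (rule has_vector_derivative_transform[where f="\<lambda>t. integral cell \<phi>"])
       (auto simp: e_def integral_translate[OF contphi per])
  ultimately have "integral cell (partial_deriv j \<phi>) = 0"
    using vector_derivative_unique_within_closed_interval[of 0 "2 * pi" 0]
    by (simp add: eta_contract_eq)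
  then show ?thesis
    using lebesgue_integral_eq_integral[OF continuous_integrable_cell[OF cont]] by simp
qed

section \<open>Hartley functions: derivatives and orthonormality\<close>

definition freq :: "int ^ 'd \<Rightarrow> real ^ 'd" where
  "freq k = (\<chi> i. of_int (k $ i))"

text \<open>Using cos + sin gives one real function for each integer vector, with no choice of a
  half lattice and the same normalization for \<open>k = 0\<close>: its square before scaling is 1
  plus a sine of mean zero.\<close>

definition hart :: "int ^ 'd \<Rightarrow> real ^ 'd \<Rightarrow> real" where
  "hart k x = (cos (freq k \<bullet> x) + sin (freq k \<bullet> x)) / sqrt (measure lebesgue (cell :: (real ^ 'd) set))"

lemma freq_simps [simp]:
  "freq (k + l) = freq k + freq l" "freq (k - l) = freq k - freq l" "freq (- k) = - freq k"
  "freq 0 = 0" "freq k $ i = of_int (k $ i)"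
  by (auto simp: freq_def vec_eq_iff)

lemma periodic_trig: "periodic (\<lambda>x. cos (freq k \<bullet> x))" "periodic (\<lambda>x. sin (freq k \<bullet> x))"
proof -
  have "freq k \<bullet> (x + (2 * pi) *\<^sub>R axis i 1) = freq k \<bullet> x + (2 * pi) * of_int (k $ i)" for i x
    by (simp add: inner_right_distrib inner_axis)
  then show "periodic (\<lambda>x. cos (freq k \<bullet> x))" "periodic (\<lambda>x. sin (freq k \<bullet> x))"
    by (auto simp: periodic_def cos_add sin_add)
qed

lemma periodic_hart: "periodic (hart k)"
  using periodic_trig[of k] by (auto simp: periodic_def hart_def)

text \<open>The derivative of cos + sin is cos - sin, which is cos + sin at the opposite frequency.
  A second derivative along the same axis therefore returns to \<open>k\<close>.\<close>

lemma has_derivative_hart: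
  "(hart k has_derivative (\<lambda>h. (freq k \<bullet> h) * hart (- k) x)) (at x)"
  unfolding hart_def [abs_def]
  by (rule derivative_eq_intros refl | simp add: measure_cell_pos[THEN less_imp_neq, symmetric])+
     (simp add: algebra_simps add_divide_distrib diff_divide_distrib)

lemma partial_deriv_hart: "partial_deriv i (\<lambda>x. c * hart k x) = (\<lambda>x. c * of_int (k $ i) * hart (- k) x)"
proof
  fix x
  have "((\<lambda>x. c * hart k x) has_derivative (\<lambda>h. c * ((freq k \<bullet> h) * hart (- k) x))) (at x)"
    by (intro has_derivative_mult_right has_derivative_hart)
  from partial_deriv_eq[OF this, of i]
  show "partial_deriv i (\<lambda>x. c * hart k x) x = c * of_int (k $ i) * hart (- k) x"
    by (simp add: inner_axis)
qed

lemma continuous_hart [continuous_intros]: "continuous_on S (hart k)"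
  unfolding hart_def[abs_def] using measure_cell_pos[where 'd='a]
  by (intro continuous_intros) auto

lemma iterated_partial_deriv_hart: "\<exists>c l. foldr partial_deriv js (hart k) = (\<lambda>x. c * hart l x)"
proof (induction js)
  case Nil
  show ?case by (rule exI[of _ 1], rule exI[of _ k]) simp
next
  case (Cons i js)
  then obtain c l where "foldr partial_deriv js (hart k) = (\<lambda>x. c * hart l x)" by blast
  then have "foldr partial_deriv (i # js) (hart k) = (\<lambda>x. (c * of_int (l $ i)) * hart (- l) x)"
    by (simp add: partial_deriv_hart)
  then show ?case by blast
qed

lemma test_fun_hart: "test_fun (hart k)"
  unfolding test_fun_def
proof (intro conjI allI periodic_hart)
  fix js x
  obtain c l where eq: "foldr partial_deriv js (hart k) = (\<lambda>x. c * hart l x)"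
    using iterated_partial_deriv_hart by blast
  show "foldr partial_deriv js (hart k) differentiable at x"
    unfolding eq using has_derivative_mult_right[OF has_derivative_hart] differentiableI by blast
qed

text \<open>For \<open>k \<noteq> 0\<close> some component \<open>k $ j\<close> is nonzero, and each
  integrand times this factor is, up to sign, a partial derivative of a periodic function.\<close>

lemma integral_trig:
  fixes k :: "int ^ 'd"
  shows "(LINT x|lebesgue_on cell. cos (freq k \<bullet> x)) = (if k = 0 then measure lebesgue (cell :: (real ^ 'd) set) else 0)"
    and "(LINT x|lebesgue_on cell. sin (freq k \<bullet> x)) = 0"
proof -
  have ds: "((\<lambda>x. sin (freq k \<bullet> x)) has_derivative (\<lambda>h. (freq k \<bullet> h) * cos (freq k \<bullet> x))) (at x)" for x
    by (auto intro!: derivative_eq_intros)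
  have dc: "((\<lambda>x. cos (freq k \<bullet> x)) has_derivative (\<lambda>h. (freq k \<bullet> h) * (- sin (freq k \<bullet> x)))) (at x)" for x
    by (auto intro!: derivative_eq_intros)
  have "(LINT x|lebesgue_on cell. cos (freq k \<bullet> x)) = 0 \<and> (LINT x|lebesgue_on cell. sin (freq k \<bullet> x)) = 0"
    if "k \<noteq> 0"
  proof -
    obtain j where j: "k $ j \<noteq> 0"
      using \<open>k \<noteq> 0\<close> by (metis vec_eq_iff zero_index)
    have pd: "partial_deriv j (\<lambda>x. sin (freq k \<bullet> x)) = (\<lambda>x. of_int (k $ j) * cos (freq k \<bullet> x))"
      "partial_deriv j (\<lambda>x. cos (freq k \<bullet> x)) = (\<lambda>x. - of_int (k $ j) * sin (freq k \<bullet> x))"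
      by (auto simp: partial_deriv_eq[OF ds] partial_deriv_eq[OF dc] inner_axis)
    have "(LINT x|lebesgue_on cell. of_int (k $ j) * cos (freq k \<bullet> x)) = 0"
      using integral_partial_deriv[of "\<lambda>x. sin (freq k \<bullet> x)" j] unfolding pd
      using ds differentiableI periodic_trig by (fastforce intro!: continuous_intros)
    moreover have "(LINT x|lebesgue_on cell. - of_int (k $ j) * sin (freq k \<bullet> x)) = 0"
      using integral_partial_deriv[of "\<lambda>x. cos (freq k \<bullet> x)" j] unfolding pd
      using dc differentiableI periodic_trig by (fastforce intro!: continuous_intros)
    ultimately show ?thesis
      using j by simp
  qed
  then show "(LINT x|lebesgue_on cell. cos (freq k \<bullet> x)) = (if k = 0 then measure lebesgue (cell :: (real ^ 'd) set) else 0)"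
    "(LINT x|lebesgue_on cell. sin (freq k \<bullet> x)) = 0"
    by (cases "k = 0"; simp add: measure_restrict_space)+
qed

text \<open>The like terms combine to a cosine of the difference, the mixed ones to a sine of the
  sum. Only the cosine can have nonzero mean, which gives orthogonality; the formula also shows that
  products stay trigonometric.\<close>

lemma hart_mult:
  fixes k l :: "int ^ 'd"
  shows "hart k x * hart l x = (cos (freq (k - l) \<bullet> x) + sin (freq (k + l) \<bullet> x)) / measure lebesgue (cell :: (real ^ 'd) set)"
  using measure_cell_pos[where 'd='d]
  by (simp add: hart_def inner_diff_left inner_add_left cos_diff sin_add algebra_simps)

lemma integral_hart_mult: "(LINT x|lebesgue_on cell. hart k x * hart l x) = (if k = l then 1 else 0)"
  unfolding hart_mult
  using measure_cell_pos[where 'd='a]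
  by (simp add: integral_trig continuous_integrable_cell continuous_intros del: freq_simps)

section \<open>Density and completeness of trigonometric polynomials\<close>

inductive_set trig :: "(real ^ 'd \<Rightarrow> real) set" where
  trig_hart: "(\<lambda>x. c * hart k x) \<in> trig"
| trig_add: "\<phi> \<in> trig \<Longrightarrow> \<psi> \<in> trig \<Longrightarrow> (\<lambda>x. \<phi> x + \<psi> x) \<in> trig"

lemma trig_cmult: "\<phi> \<in> trig \<Longrightarrow> (\<lambda>x. c * \<phi> x) \<in> trig"
proof (induction rule: trig.induct)
  case (trig_hart c' k)
  show ?case using trig.trig_hart[of "c * c'" k] by (simp add: mult.assoc)
qed (simp add: distrib_left trig.trig_add)

lemma cos_sin_trig:
  "(\<lambda>x :: real ^ 'd. cos (freq k \<bullet> x)) \<in> trig" "(\<lambda>x :: real ^ 'd. sin (freq k \<bullet> x)) \<in> trig"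
proof -
  let ?r = "sqrt (measure lebesgue (cell :: (real ^ 'd) set)) / 2"
  have "(\<lambda>x. ?r * hart k x + ?r * hart (- k) x) \<in> trig" "(\<lambda>x. ?r * hart k x + (- ?r) * hart (- k) x) \<in> trig"
    by (intro trig.intros)+
  moreover have "cos (freq k \<bullet> x) = ?r * hart k x + ?r * hart (- k) x"
    "sin (freq k \<bullet> x) = ?r * hart k x + (- ?r) * hart (- k) x" for x
    using measure_cell_pos[where 'd='d] by (simp_all add: hart_def field_simps)
  ultimately show "(\<lambda>x :: real ^ 'd. cos (freq k \<bullet> x)) \<in> trig" "(\<lambda>x :: real ^ 'd. sin (freq k \<bullet> x)) \<in> trig"
    by simp_all
qed

lemma trig_const: "(\<lambda>x. c) \<in> trig"
  using trig_cmult[OF cos_sin_trig(1)[of 0], of c] by simp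

lemma trig_mult: "\<phi> \<in> trig \<Longrightarrow> \<psi> \<in> trig \<Longrightarrow> (\<lambda>x. \<phi> x * \<psi> x) \<in> trig"
proof (induction rule: trig.induct)
  case (trig_hart c k)
  then show ?case
  proof (induction rule: trig.induct)
    case (trig_hart c' l)
    let ?v = "measure lebesgue (cell :: (real ^ 'a) set)"
    have "(\<lambda>x. (c * c' / ?v) * (cos (freq (k - l) \<bullet> x) + sin (freq (k + l) \<bullet> x))) \<in> trig"
      by (intro trig_cmult trig.trig_add cos_sin_trig)
    moreover have "(c * hart k x) * (c' * hart l x)
        = (c * c' / ?v) * (cos (freq (k - l) \<bullet> x) + sin (freq (k + l) \<bullet> x))" for x
      using hart_mult[of k x l] by (simp add: mult_ac)
    ultimately show ?case by simp
  next
    case (trig_add \<phi> \<psi>)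
    then show ?case using trig.trig_add by (simp add: distrib_left)
  qed
next
  case (trig_add \<phi> \<psi>)
  then show ?case using trig.trig_add by (simp add: distrib_right)
qed

lemma continuous_trig: "\<phi> \<in> trig \<Longrightarrow> continuous_on S \<phi>"
  by (induction rule: trig.induct) (auto intro: continuous_on_mult_left continuous_on_add continuous_hart)

lemma trig_expand:
  assumes "\<phi> \<in> trig"
  obtains K p where "finite K" "\<phi> = (\<lambda>x. \<Sum>k\<in>K. p k * hart k x)"
proof -
  have "\<exists>K p. finite K \<and> \<phi> = (\<lambda>x. \<Sum>k\<in>K. p k * hart k x)"
    using assms
  proof (induction rule: trig.induct)
    case (trig_hart c k)
    show ?case by (rule exI[of _ "{k}"], rule exI[of _ "\<lambda>_. c"]) simp
  next
    case (trig_add \<phi> \<psi>)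
    then obtain K p L q where *: "finite K" "\<phi> = (\<lambda>x. \<Sum>k\<in>K. p k * hart k x)"
      "finite L" "\<psi> = (\<lambda>x. \<Sum>k\<in>L. q k * hart k x)"
      by blast
    have "\<phi> x = (\<Sum>k\<in>K \<union> L. (if k \<in> K then p k else 0) * hart k x)" for x
      unfolding * using * by (intro sum.mono_neutral_cong_left) auto
    moreover have "\<psi> x = (\<Sum>k\<in>K \<union> L. (if k \<in> L then q k else 0) * hart k x)" for x
      unfolding * using * by (intro sum.mono_neutral_cong_left) auto
    ultimately have "(\<lambda>x. \<phi> x + \<psi> x)
        = (\<lambda>x. \<Sum>k\<in>K \<union> L. ((if k \<in> K then p k else 0) + (if k \<in> L then q k else 0)) * hart k x)"
      by (simp add: sum.distrib distrib_right)
    with *(1,3) show ?case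
      by (intro exI[of _ "K \<union> L"] exI[of _ "\<lambda>k. (if k \<in> K then p k else 0) + (if k \<in> L then q k else 0)"]) auto
  qed
  with that show thesis by blast
qed

text \<open>Periodic functions cannot separate points on opposite faces of the cell. This map
  identifies exactly such points, so its image is a compact model of the torus on which
  Stone-Weierstrass applies.\<close>

definition torus_emb :: "real ^ 'd \<Rightarrow> complex ^ 'd" where
  "torus_emb x = (\<chi> i. cis (x $ i))"

lemma continuous_torus_emb: "continuous_on S torus_emb"
  unfolding torus_emb_def cis_conv_exp by (intro continuous_intros)

text \<open>Coordinates with the same image differ by a multiple of \<open>2 * pi\<close>; if one of
  the points is strictly inside the cell, the difference is smaller than \<open>2 * pi\<close>,
  hence zero.\<close>

lemma torus_emb_eq:
  assumes "torus_emb x = torus_emb y" "x \<in> interior cell" "y \<in> cell"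
  shows "x = y"
proof -
  have "x $ i = y $ i" for i
  proof -
    have "cis (x $ i) = cis (y $ i)"
      using assms(1) by (auto simp: torus_emb_def vec_eq_iff)
    then have "sin (x $ i) = sin (y $ i) \<and> cos (x $ i) = cos (y $ i)"
      by (metis cis.sel)
    then obtain n :: int where n: "x $ i = y $ i + 2 * pi * of_int n"
      using sin_cos_eq_iff by blast
    have "- pi < x $ i" "x $ i < pi" "- pi \<le> y $ i" "y $ i \<le> pi"
      using assms by (auto simp: cell_def interior_cbox mem_box_cart)
    with n have "\<bar>2 * pi * of_int n\<bar> < 2 * pi * 1"
      by linarith
    then have "\<bar>of_int n :: real\<bar> < 1"
      by (simp add: abs_mult)
    with n show ?thesis by simp
  qed
  then show ?thesis by (simp add: vec_eq_iff)
qed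

text \<open>Stone-Weierstrass for the ring of functions on the embedded torus whose pullback to the
  cell is a trigonometric polynomial. Real and imaginary parts of the coordinates pull back to
  cosines and sines of the \<open>x $ i\<close> and separate points.\<close>

lemma trig_dense:
  fixes F :: "complex ^ 'd \<Rightarrow> real"
  assumes "continuous_on (torus_emb ` cell) F" "\<epsilon> > 0"
  obtains \<psi> where "\<psi> \<in> trig" "\<And>x. x \<in> cell \<Longrightarrow> \<bar>F (torus_emb x) - \<psi> x\<bar> < \<epsilon>"
proof -
  define R where "R = {G. continuous_on (torus_emb ` cell) G \<and>
    (\<exists>\<psi> \<in> trig. \<forall>x \<in> (cell :: (real ^ 'd) set). G (torus_emb x) = (\<psi> x :: real))}"
  interpret function_ring_on R "torus_emb ` cell"
  proof
    show "compact (torus_emb ` (cell :: (real ^ 'd) set))"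
      unfolding cell_def by (intro compact_continuous_image continuous_torus_emb compact_cbox)
    show "(\<lambda>_. c) \<in> R" for c
      by (auto simp: R_def intro!: bexI[OF _ trig_const[of c]])
    show "(\<lambda>x. f x + g x) \<in> R" if "f \<in> R" "g \<in> R" for f g
    proof -
      obtain \<phi> \<psi> where "\<phi> \<in> trig" "\<psi> \<in> trig" "\<forall>x\<in>cell. f (torus_emb x) = \<phi> x" "\<forall>x\<in>cell. g (torus_emb x) = \<psi> x"
        using \<open>f \<in> R\<close> \<open>g \<in> R\<close> unfolding R_def by blast
      with that show ?thesis
        by (auto simp: R_def intro!: continuous_on_add bexI[OF _ trig_add[of \<phi> \<psi>]])
    qed
    show "(\<lambda>x. f x * g x) \<in> R" if "f \<in> R" "g \<in> R" for f g
    proof -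
      obtain \<phi> \<psi> where "\<phi> \<in> trig" "\<psi> \<in> trig" "\<forall>x\<in>cell. f (torus_emb x) = \<phi> x" "\<forall>x\<in>cell. g (torus_emb x) = \<psi> x"
        using \<open>f \<in> R\<close> \<open>g \<in> R\<close> unfolding R_def by blast
      with that show ?thesis
        by (auto simp: R_def intro!: continuous_on_mult bexI[OF _ trig_mult[of \<phi> \<psi>]])
    qed
    show "\<exists>f\<in>R. f x \<noteq> f y" if "x \<in> torus_emb ` cell" "y \<in> torus_emb ` cell" "x \<noteq> y" for x y :: "complex ^ 'd"
    proof -
      obtain i where "x $ i \<noteq> y $ i"
        using \<open>x \<noteq> y\<close> by (metis vec_eq_iff)
      then have ne: "Re (x $ i) \<noteq> Re (y $ i) \<or> Im (x $ i) \<noteq> Im (y $ i)"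
        by (simp add: complex_eq_iff)
      have fr: "freq (axis i 1) = axis i 1"
        by (simp add: freq_def axis_def vec_eq_iff)
      have re: "(\<lambda>z. Re (z $ i)) \<in> R"
        using cos_sin_trig(1)[of "axis i 1"]
        by (auto simp: R_def fr torus_emb_def inner_axis' intro!: continuous_intros)
      have im: "(\<lambda>z. Im (z $ i)) \<in> R"
        using cos_sin_trig(2)[of "axis i 1"]
        by (auto simp: R_def fr torus_emb_def inner_axis' intro!: continuous_intros)
      from ne show ?thesis
        by (rule disjE) (rule bexI[OF _ re] bexI[OF _ im]; assumption)+
    qed
  qed (auto simp: R_def)
  obtain G where "G \<in> R" "\<forall>z\<in>torus_emb ` cell. \<bar>F z - G z\<bar> < \<epsilon>"
    using Stone_Weierstrass_basic[OF assms] by blast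
  then show thesis
    using that by (auto simp: R_def)
qed

section \<open>Positivity tested by trigonometric polynomials\<close>

lemma integrable_mult_bounded:
  fixes w f :: "'a \<Rightarrow> real"
  assumes "integrable M w" "f \<in> borel_measurable M" "AE x in M. \<bar>f x\<bar> \<le> B"
  shows "integrable M (\<lambda>x. w x * f x)"
proof (rule Bochner_Integration.integrable_bound)
  show "integrable M (\<lambda>x. B * w x)" using assms by simp
  show "AE x in M. norm (w x * f x) \<le> norm (B * w x)"
    using assms(3)
  proof eventually_elim
    case (elim x)
    then have "\<bar>w x\<bar> * \<bar>f x\<bar> \<le> \<bar>w x\<bar> * \<bar>B\<bar>" by (intro mult_left_mono) auto
    then show ?case by (simp add: abs_mult mult.commute)
  qed
qed (use assms in auto)

lemma integrable_mult_continuous: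
  fixes w f :: "real ^ 'd \<Rightarrow> real"
  assumes "integrable (lebesgue_on cell) w" "continuous_on UNIV f"
  shows "integrable (lebesgue_on cell) (\<lambda>x. w x * f x)"
proof -
  have "compact (f ` cell)"
    unfolding cell_def by (intro compact_continuous_image continuous_on_subset[OF assms(2)]) auto
  then have "bounded (f ` cell)"
    by (rule compact_imp_bounded)
  then obtain B where "\<forall>x\<in>cell. norm (f x) \<le> B"
    by (auto simp: bounded_iff)
  then have "AE x in lebesgue_on cell. \<bar>f x\<bar> \<le> B"
    by (intro AE_I2) auto
  then show ?thesis
    using assms continuous_integrable_cell[OF assms(2)] by (intro integrable_mult_bounded) auto
qed

text \<open>The class of test functions is enlarged in stages: nonnegative trigonometric
  polynomials, continuous functions on the embedded torus with values in [0, 1], indicators of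
  closed sets. The set where \<open>w < 0\<close> is, up to null sets, a countable union of closed
  sets, and each of these is shown to be null.\<close>

lemma nonneg_if_trig_nonneg:
  fixes w :: "real ^ 'd \<Rightarrow> real"
  assumes w: "integrable (lebesgue_on cell) w"
    and nn: "\<And>\<psi>. \<psi> \<in> trig \<Longrightarrow> (\<And>x. x \<in> cell \<Longrightarrow> 0 \<le> \<psi> x) \<Longrightarrow> 0 \<le> (LINT x|lebesgue_on cell. w x * \<psi> x)"
  shows "AE x in lebesgue_on cell. 0 \<le> w x"
proof -
  let ?M = "lebesgue_on (cell :: (real ^ 'd) set)"
  have meas: "(\<lambda>x. F (torus_emb x)) \<in> borel_measurable ?M" if "F \<in> borel_measurable borel" for F :: "complex ^ 'd \<Rightarrow> real"
  proof -
    have "(torus_emb :: real ^ 'd \<Rightarrow> _) \<in> borel_measurable borel"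
      by (rule borel_measurable_continuous_onI) (rule continuous_torus_emb)
    then have "(\<lambda>x :: real ^ 'd. F (torus_emb x)) \<in> borel_measurable borel"
      using that by simp
    then show ?thesis
      by (simp add: measurable_restrict_space1 measurable_completion)
  qed
  have cont: "0 \<le> (LINT x|?M. w x * F (torus_emb x))"
    if F: "continuous_on UNIV F" "\<And>y. 0 \<le> F y" "\<And>y. F y \<le> 1" for F :: "complex ^ 'd \<Rightarrow> real"
  proof (rule ccontr)
    define J where "J = (LINT x|?M. w x * F (torus_emb x))"
    define I where "I = (LINT x|?M. \<bar>w x\<bar>)"
    \<comment> \<open>With this choice \<open>2 * \<epsilon> * I < - J / 2\<close>, so the
      approximation error cannot compensate a negative \<open>J\<close>. The summand 1 keeps the
      denominator positive.\<close>
    define \<epsilon> where "\<epsilon> = - J / (4 * (I + 1))"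
    assume "\<not> 0 \<le> (LINT x|?M. w x * F (torus_emb x))"
    then have J: "J < 0" by (simp add: J_def)
    have I: "I \<ge> 0" by (simp add: I_def)
    with J have eps: "\<epsilon> > 0" by (simp add: \<epsilon>_def divide_neg_pos)
    obtain \<psi> where \<psi>: "\<psi> \<in> trig" "\<And>x. x \<in> cell \<Longrightarrow> \<bar>F (torus_emb x) - \<psi> x\<bar> < \<epsilon>"
      using trig_dense[OF continuous_on_subset[OF F(1)] eps] by blast
    have Fm: "F \<in> borel_measurable borel"
      using F(1) by (rule borel_measurable_continuous_onI)
    have i1: "integrable ?M (\<lambda>x. w x * (\<psi> x + \<epsilon>))"
      by (rule integrable_mult_continuous[OF w]) (intro continuous_intros continuous_trig \<psi>)
    have i2: "integrable ?M (\<lambda>x. w x * F (torus_emb x))"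
      using F by (intro integrable_mult_bounded[where B=1] w meas Fm) auto
    \<comment> \<open>Raising the approximant by \<open>\<epsilon>\<close> makes it nonnegative on
      the cell, at the price of an error up to \<open>2 * \<epsilon>\<close>.\<close>
    have "0 \<le> (LINT x|?M. w x * (\<psi> x + \<epsilon>))"
    proof (rule nn)
      show "(\<lambda>x. \<psi> x + \<epsilon>) \<in> trig" by (intro trig_add \<psi> trig_const)
      show "0 \<le> \<psi> x + \<epsilon>" if "x \<in> cell" for x
        using \<psi>(2)[OF that] F(2)[of "torus_emb x"] by linarith
    qed
    also have "\<dots> \<le> (LINT x|?M. w x * F (torus_emb x) + 2 * \<epsilon> * \<bar>w x\<bar>)"
    proof (rule integral_mono)
      fix x assume "x \<in> space ?M"
      then have "\<bar>\<psi> x + \<epsilon> - F (torus_emb x)\<bar> \<le> 2 * \<epsilon>"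
        using \<psi>(2)[of x] by simp
      then have "\<bar>w x\<bar> * \<bar>\<psi> x + \<epsilon> - F (torus_emb x)\<bar> \<le> \<bar>w x\<bar> * (2 * \<epsilon>)"
        by (intro mult_left_mono) auto
      then have "w x * (\<psi> x + \<epsilon> - F (torus_emb x)) \<le> \<bar>w x\<bar> * (2 * \<epsilon>)"
        by (simp add: abs_mult[symmetric])
      then show "w x * (\<psi> x + \<epsilon>) \<le> w x * F (torus_emb x) + 2 * \<epsilon> * \<bar>w x\<bar>"
        by (simp add: algebra_simps)
    qed (use i1 i2 w in auto)
    also have "\<dots> = J + 2 * \<epsilon> * I"
      using i2 w by (simp add: J_def I_def)
    finally have "0 \<le> J + 2 * \<epsilon> * I" .
    moreover have "\<epsilon> * (4 * (I + 1)) = - J"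
      unfolding \<epsilon>_def using I by (intro nonzero_eq_divide_eq[THEN iffD1]) auto
    then have "4 * (\<epsilon> * I) + 4 * \<epsilon> = - J"
      by (simp add: algebra_simps)
    ultimately show False using eps J by linarith
  qed
  have closed: "0 \<le> (LINT x|?M. w x * indicator C (torus_emb x))" if C: "closed C" "C \<noteq> {}" for C :: "(complex ^ 'd) set"
  proof (rule LIMSEQ_le_const)
    \<comment> \<open>Continuous bumps that decrease to the indicator of \<open>C\<close>.
      Nonemptiness of \<open>C\<close> matters here: \<open>infdist\<close> to the empty set is 0 by
      convention.\<close>
    define F where "F n y = max 0 (1 - real n * infdist y C)" for n y
    have Fc: "continuous_on UNIV (F n)" for n
      unfolding F_def[abs_def] by (intro continuous_intros)
    have Fm: "F n \<in> borel_measurable borel" for n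
      using Fc by (rule borel_measurable_continuous_onI)
    have F01: "0 \<le> F n y" "F n y \<le> 1" for n y
      by (auto simp: F_def infdist_nonneg)
    have Flim: "(\<lambda>n. F n y) \<longlonglongrightarrow> indicator C y" for y
    proof (cases "y \<in> C")
      case True
      then show ?thesis by (simp add: F_def)
    next
      case False
      then have pos: "infdist y C > 0"
        using C in_closed_iff_infdist_zero[of C y] infdist_nonneg[of y C] by force
      have "\<forall>\<^sub>F n in sequentially. F n y = 0"
        using eventually_ge_at_top[of "nat \<lceil>1 / infdist y C\<rceil>"]
      proof eventually_elim
        case (elim n)
        then have "1 / infdist y C \<le> real n" by linarith
        then show ?case using pos by (simp add: F_def field_simps)
      qed
      then show ?thesis using False by (simp add: tendsto_eventually)
    qed
    show "(\<lambda>n. LINT x|?M. w x * F n (torus_emb x)) \<longlonglongrightarrow> (LINT x|?M. w x * indicator C (torus_emb x))"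
    proof (rule integral_dominated_convergence)
      show "(\<lambda>x. w x * indicator C (torus_emb x)) \<in> borel_measurable ?M"
        using C w by (intro borel_measurable_times meas) auto
      show "(\<lambda>x. w x * F n (torus_emb x)) \<in> borel_measurable ?M" for n
        using w by (intro borel_measurable_times meas Fm) auto
      show "integrable ?M (\<lambda>x. \<bar>w x\<bar>)" using w by simp
      show "AE x in ?M. (\<lambda>n. w x * F n (torus_emb x)) \<longlonglongrightarrow> w x * indicator C (torus_emb x)"
        by (intro AE_I2 tendsto_intros Flim)
      show "AE x in ?M. norm (w x * F n (torus_emb x)) \<le> \<bar>w x\<bar>" for n
        using F01 by (auto simp: abs_mult intro!: AE_I2 mult_left_le)
    qed
    show "\<exists>N. \<forall>n\<ge>N. 0 \<le> (LINT x|?M. w x * F n (torus_emb x))"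
      using cont[OF Fc F01] by blast
  qed
  \<comment> \<open>Restricting to the interior loses only a null set and makes
    \<open>torus_emb\<close> injective there, so indicators of compact subsets of \<open>S\<close>
    are pullbacks from the embedded torus.\<close>
  define S where "S = {x \<in> interior cell. w x < 0}"
  have intS: "interior (cell :: (real ^ 'd) set) \<subseteq> cell" by (rule interior_subset)
  have "{x \<in> space ?M. w x < 0} \<in> sets ?M"
    using borel_measurable_integrable[OF w] by measurable
  then have "{x \<in> cell. w x < 0} \<in> sets lebesgue"
    by (simp add: sets_restrict_space_iff)
  then have "{x \<in> cell. w x < 0} \<inter> interior cell \<in> sets lebesgue"
    by (intro sets.Int) (auto simp: borel_open)
  moreover have "{x \<in> cell. w x < 0} \<inter> interior cell = S"
    using intS by (auto simp: S_def)
  ultimately have "S \<in> sets lebesgue" by simp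
  then obtain C T where CT: "fsigma C" "T \<in> null_sets lebesgue" "C \<union> T = S"
    using lebesgue_set_almost_fsigma by metis
  obtain K where K: "\<And>n::nat. closed (K n)" "C = \<Union> (range K)"
    using \<open>fsigma C\<close> by (auto elim!: fsigma.cases)
  \<comment> \<open>On \<open>K n\<close> the function \<open>w\<close> is negative, yet its
    integral over \<open>K n\<close> is nonnegative, which forces \<open>K n\<close> to be
    null.\<close>
  have null: "AE x in ?M. x \<notin> K n" for n
  proof (cases "K n = {}")
    case False
    have KS: "K n \<subseteq> S" using K CT by blast
    then have Kc: "K n \<subseteq> cell" using intS by (auto simp: S_def)
    then have "bounded (K n)"
      unfolding cell_def using bounded_cbox bounded_subset by blast
    with K have "compact (K n)" by (simp add: compact_eq_bounded_closed)
    then have "closed (torus_emb ` K n)"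
      by (intro compact_imp_closed compact_continuous_image continuous_torus_emb)
    then have "0 \<le> (LINT x|?M. w x * indicator (torus_emb ` K n) (torus_emb x))"
      using False by (intro closed) auto
    also have "\<dots> = (LINT x|?M. w x * indicator (K n) x)"
    proof (rule Bochner_Integration.integral_cong)
      fix x assume "x \<in> space ?M"
      then have "torus_emb x \<in> torus_emb ` K n \<longleftrightarrow> x \<in> K n"
        using KS torus_emb_eq[of _ x] by (auto simp: S_def)
      then show "w x * indicator (torus_emb ` K n) (torus_emb x) = w x * indicator (K n) x"
        by (simp add: indicator_def)
    qed simp
    finally have ge: "0 \<le> (LINT x|?M. w x * indicator (K n) x)" .
    have le: "w x * indicator (K n) x \<le> 0" for x
      using KS by (auto simp: S_def indicator_def)
    have Km: "K n \<in> sets ?M"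
      using K(1)[of n] Kc by (auto simp: sets_restrict_space_iff borel_closed)
    have i: "integrable ?M (\<lambda>x. - (w x * indicator (K n) x))"
      using integrable_mult_indicator[OF Km w] by (simp add: mult.commute)
    have "(LINT x|?M. - (w x * indicator (K n) x)) = 0"
      using ge integral_nonneg_AE[of "\<lambda>x. - (w x * indicator (K n) x)" ?M] le by simp
    then have "AE x in ?M. - (w x * indicator (K n) x) = 0"
      using integral_nonneg_eq_0_iff_AE[OF i] le by simp
    then show ?thesis
      by eventually_elim (use KS in \<open>auto simp: S_def indicator_def split: if_splits\<close>)
  qed simp
  have "AE x in lebesgue. x \<notin> T"
    using CT by (rule_tac AE_not_in)
  then have T: "AE x in ?M. x \<notin> T"
    by (subst AE_restrict_space_iff) (auto elim: eventually_mono)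
  have "negligible (cell - interior (cell :: (real ^ 'd) set))"
    unfolding cell_def interior_cbox by (rule negligible_frontier_interval)
  then have "AE x in lebesgue. x \<notin> cell - interior (cell :: (real ^ 'd) set)"
    by (intro AE_not_in) (simp add: negligible_iff_null_sets)
  then have "AE x in ?M. x \<in> interior cell"
    by (subst AE_restrict_space_iff) (auto elim: eventually_mono)
  moreover have "AE x in ?M. \<forall>n. x \<notin> K n"
    using null by (simp add: AE_all_countable)
  ultimately show ?thesis
    using T
  proof eventually_elim
    case (elim x)
    then have "x \<notin> S" using CT K by blast
    with elim show ?case by (auto simp: S_def)
  qed
qed

text \<open>For completeness: if all coefficients vanish, so do the integrals against all
  trigonometric polynomials, and the positivity test applies to both \<open>f\<close> and
  \<open>- f\<close>.\<close>

interpretation torus: orthonormal_basis "lebesgue_on (cell :: (real ^ 'd) set)" hart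
proof -
  let ?M = "lebesgue_on (cell :: (real ^ 'd) set)"
  interpret finite_measure ?M by (rule finite_measure_cell)
  interpret orthonormal_family ?M hart
    by unfold_locales
      (auto intro!: continuous_square_integrable_cell continuous_hart simp: integral_hart_mult)
  show "orthonormal_basis ?M hart"
  proof
    fix f assume f: "square_integrable ?M f" "\<And>k. coef f k = 0"
    have int: "integrable ?M f"
      using f(1) by (rule integrable_if_square_integrable)
    have zero: "(LINT x|?M. f x * \<psi> x) = 0" if "\<psi> \<in> trig" for \<psi>
      using that
    proof (induction rule: trig.induct)
      case (trig_hart c k)
      show ?case using f(2)[of k] by (simp add: coef_def mult.left_commute[of _ c])
    next
      case (trig_add \<phi> \<psi>)
      moreover have "integrable ?M (\<lambda>x. f x * \<phi> x)" "integrable ?M (\<lambda>x. f x * \<psi> x)"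
        using trig_add.hyps by (auto intro!: integrable_mult_continuous[OF int] continuous_trig)
      ultimately show ?case
        by (simp add: distrib_left)
    qed
    have "AE x in ?M. 0 \<le> f x"
      by (rule nonneg_if_trig_nonneg[OF int]) (simp add: zero)
    moreover have "AE x in ?M. 0 \<le> - f x"
      by (rule nonneg_if_trig_nonneg) (simp_all add: zero int)
    ultimately show "AE x in ?M. f x = 0"
      by eventually_elim simp
  qed
qed

section \<open>The maximum principle\<close>

text \<open>If \<open>D < 0\<close>, then \<open>g'\<close>, which vanishes at the minimum, is
  negative just to the right of 0, and the mean value theorem puts a value of \<open>g\<close> below
  the minimum.\<close>

lemma second_derivative_nonneg_at_min:
  fixes g g' :: "real \<Rightarrow> real"
  assumes g: "\<And>t. (g has_real_derivative g' t) (at t)" and g': "(g' has_real_derivative D) (at 0)"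
    and min: "\<And>t. g 0 \<le> g t"
  shows "0 \<le> D"
proof (rule ccontr)
  assume "\<not> 0 \<le> D"
  then obtain d where d: "d > 0" "\<And>h. 0 < h \<Longrightarrow> h < d \<Longrightarrow> g' (0 + h) < g' 0"
    using DERIV_neg_dec_right[OF g'] by auto
  have "g' 0 = 0"
    by (rule DERIV_local_min[OF g, of 1]) (auto intro: min)
  moreover obtain z where z: "0 < z" "z < d / 2" "g (d / 2) - g 0 = (d / 2 - 0) * g' z"
    using MVT2[of 0 "d / 2" g g'] g d(1) by auto
  ultimately have "(d / 2) * g' z < 0"
    using d(2)[of z] d(1) by (intro mult_pos_neg) auto
  with z(3) min[of "d / 2"] show False by simp
qed

text \<open>Turns a minimum over the compact cell into a global one, so that two-sided derivative
  tests apply even if it is attained on the boundary of the cell.\<close>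

lemma reduce_to_cell:
  fixes x :: "real ^ 'd"
  obtains y where "y \<in> cell" "\<And>k. hart k x = hart k y"
proof -
  define n where "n i = \<lfloor>(x $ i + pi) / (2 * pi)\<rfloor>" for i
  define y where "y = (\<chi> i. x $ i - 2 * pi * of_int (n i))"
  have "- pi \<le> y $ i \<and> y $ i \<le> pi" for i
  proof -
    have "of_int (n i) \<le> (x $ i + pi) / (2 * pi)" "(x $ i + pi) / (2 * pi) < of_int (n i) + 1"
      unfolding n_def by linarith+
    then show ?thesis by (simp add: y_def field_simps)
  qed
  then have "y \<in> cell" by (simp add: mem_cell)
  moreover have "hart k x = hart k y" for k
  proof -
    have "freq k \<bullet> x = (\<Sum>i\<in>UNIV. of_int (k $ i) * (y $ i) + 2 * pi * of_int (k $ i * n i))"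
      unfolding inner_vec_def by (intro sum.cong) (auto simp: y_def algebra_simps)
    also have "\<dots> = freq k \<bullet> y + 2 * pi * of_int (\<Sum>i\<in>UNIV. k $ i * n i)"
      by (simp add: sum.distrib sum_distrib_left inner_vec_def)
    finally show ?thesis
      by (simp add: hart_def cos_add sin_add del: of_int_sum of_int_mult)
  qed
  ultimately show thesis using that by blast
qed

lemma has_derivative_hart_line:
  "((\<lambda>t. hart k (x + t *\<^sub>R axis i 1)) has_real_derivative of_int (k $ i) * hart (- k) (x + t *\<^sub>R axis i 1)) (at t)"
proof -
  have "((\<lambda>t. x + t *\<^sub>R axis i 1) has_derivative (\<lambda>h. h *\<^sub>R axis i 1)) (at t)"
    by (auto intro!: derivative_eq_intros)
  from has_derivative_compose[OF this has_derivative_hart, of k]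
  show ?thesis
    unfolding has_field_derivative_def
    by (rule has_derivative_eq_rhs) (auto simp: fun_eq_iff inner_axis)
qed

text \<open>At a minimum point of \<open>\<theta> = (1 - b \<Delta>)\<^sup>-\<^sup>1 \<psi>\<close> one has \<open>\<Delta>\<theta> \<ge> 0\<close>, hence \<open>\<theta> \<ge> \<psi> \<ge> 0\<close> there.\<close>

lemma resolvent_nonneg:
  fixes p :: "int ^ 'd \<Rightarrow> real"
  assumes K: "finite K" and b: "b > 0" and nn: "\<And>x. 0 \<le> (\<Sum>k\<in>K. p k * hart k x)"
  shows "0 \<le> (\<Sum>k\<in>K. p k / (1 + b * (freq k \<bullet> freq k)) * hart k x)"
proof -
  define q where "q k = p k / (1 + b * (freq k \<bullet> freq k))" for k
  define \<theta> where "\<theta> x = (\<Sum>k\<in>K. q k * hart k x)" for x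
  have "continuous_on cell \<theta>"
    unfolding \<theta>_def[abs_def] by (intro continuous_intros)
  moreover have "compact (cell :: (real ^ 'd) set)" "(cell :: (real ^ 'd) set) \<noteq> {}"
    using measure_cell_pos[where 'd='d] by (auto simp: cell_def)
  ultimately obtain z where z: "z \<in> cell" "\<And>x. x \<in> cell \<Longrightarrow> \<theta> z \<le> \<theta> x"
    using continuous_attains_inf by metis
  have min: "\<theta> z \<le> \<theta> x" for x
  proof -
    obtain y where "y \<in> cell" "\<And>k. hart k x = hart k y"
      using reduce_to_cell by blast
    with z(2)[of y] show ?thesis by (simp add: \<theta>_def)
  qed
  have "0 \<le> (\<Sum>k\<in>K. q k * (of_int (k $ i) * (of_int (- k $ i) * hart k z)))" for i
  proof (rule second_derivative_nonneg_at_min)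
    show "((\<lambda>t. \<theta> (z + t *\<^sub>R axis i 1)) has_real_derivative
        (\<Sum>k\<in>K. q k * (of_int (k $ i) * hart (- k) (z + t *\<^sub>R axis i 1)))) (at t)" for t
      unfolding \<theta>_def by (intro DERIV_sum DERIV_cmult has_derivative_hart_line)
    have "((\<lambda>t. \<Sum>k\<in>K. q k * (of_int (k $ i) * hart (- k) (z + t *\<^sub>R axis i 1))) has_real_derivative
        (\<Sum>k\<in>K. q k * (of_int (k $ i) * (of_int ((- k) $ i) * hart (- (- k)) (z + 0 *\<^sub>R axis i 1))))) (at 0)"
      by (intro DERIV_sum DERIV_cmult has_derivative_hart_line)
    then show "((\<lambda>t. \<Sum>k\<in>K. q k * (of_int (k $ i) * hart (- k) (z + t *\<^sub>R axis i 1))) has_real_derivative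
        (\<Sum>k\<in>K. q k * (of_int (k $ i) * (of_int (- k $ i) * hart k z)))) (at 0)"
      by simp
    show "\<theta> (z + 0 *\<^sub>R axis i 1) \<le> \<theta> (z + t *\<^sub>R axis i 1)" for t
      using min by simp
  qed
  then have "0 \<le> (\<Sum>i\<in>UNIV. \<Sum>k\<in>K. q k * (of_int (k $ i) * (of_int (- k $ i) * hart k z)))"
    by (rule sum_nonneg)
  also have "\<dots> = (\<Sum>k\<in>K. \<Sum>i\<in>UNIV. q k * (of_int (k $ i) * (of_int (- k $ i) * hart k z)))"
    by (rule sum.swap)
  also have "\<dots> = - (\<Sum>k\<in>K. q k * (freq k \<bullet> freq k) * hart k z)"
    by (simp add: inner_vec_def sum_distrib_left sum_distrib_right sum_negf mult_ac)
  finally have le: "b * (\<Sum>k\<in>K. q k * (freq k \<bullet> freq k) * hart k z) \<le> 0"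
    using b by (simp add: mult_nonneg_nonpos)
  have "1 + b * (freq k \<bullet> freq k) \<noteq> 0" for k :: "int ^ 'd"
    using b inner_ge_zero[of "freq k"] by (smt (verit) mult_nonneg_nonneg)
  then have p: "p k = q k * (1 + b * (freq k \<bullet> freq k))" for k
    by (simp add: q_def)
  have "0 \<le> (\<Sum>k\<in>K. p k * hart k z)" by (rule nn)
  also have "\<dots> = \<theta> z + b * (\<Sum>k\<in>K. q k * (freq k \<bullet> freq k) * hart k z)"
    unfolding p \<theta>_def by (simp add: sum.distrib sum_distrib_left algebra_simps)
  finally have "0 \<le> \<theta> z" using le by linarith
  with min[of x] show ?thesis by (simp add: \<theta>_def q_def)
qed

section \<open>Pairings with Hartley functions and the scheme in Fourier coefficients\<close>

lemma integral_hart: "k \<noteq> 0 \<Longrightarrow> (LINT x|lebesgue_on cell. hart k x) = 0"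
  unfolding hart_def
  by (simp add: integral_trig continuous_integrable_cell continuous_intros)

lemma integral_mult_trig:
  fixes w :: "real ^ 'd \<Rightarrow> real"
  assumes "integrable (lebesgue_on cell) w"
  shows "(LINT x|lebesgue_on cell. w x * (\<Sum>k\<in>K. p k * hart k x)) = (\<Sum>k\<in>K. p k * torus.coef w k)"
proof -
  have "(LINT x|lebesgue_on cell. w x * (\<Sum>k\<in>K. p k * hart k x))
      = (LINT x|lebesgue_on cell. (\<Sum>k\<in>K. p k * (w x * hart k x)))"
    by (simp add: sum_distrib_left mult_ac)
  also have "\<dots> = (\<Sum>k\<in>K. p k * torus.coef w k)"
    unfolding torus.coef_def
    by (subst Bochner_Integration.integral_sum)
       (auto intro!: integrable_mult_continuous assms continuous_hart)
  finally show ?thesis .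
qed

text \<open>Only frequency 0 contributes to the integral, so a multiplier equal to 1 there, such as
  a resolvent, preserves it.\<close>

lemma integral_trig_multiplier:
  assumes "\<And>k. k = 0 \<Longrightarrow> m k = (1 :: real)"
  shows "(LINT x|lebesgue_on cell. (\<Sum>k\<in>K. p k * m k * hart k x)) = (LINT x|lebesgue_on cell. (\<Sum>k\<in>K. p k * hart k x))"
proof -
  have "p k * m k * (LINT x|lebesgue_on cell. hart k x) = p k * (LINT x|lebesgue_on cell. hart k x)" for k
    using assms[of k] integral_hart[of k] by (cases "k = 0") auto
  then have "(\<Sum>k\<in>K. p k * m k * (LINT x|lebesgue_on cell. hart k x)) = (\<Sum>k\<in>K. p k * (LINT x|lebesgue_on cell. hart k x))"
    by (rule sum.cong[OF refl])
  then show ?thesis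
    by (simp add: Bochner_Integration.integral_sum continuous_integrable_cell continuous_hart)
qed

lemma abs_integral_mult_le:
  fixes u \<phi> :: "real ^ 'd \<Rightarrow> real"
  assumes u: "integrable (lebesgue_on cell) u" "AE x in lebesgue_on cell. \<bar>u x\<bar> \<le> B"
    and \<phi>: "continuous_on UNIV \<phi>" "\<And>x. 0 \<le> \<phi> x"
  shows "\<bar>LINT x|lebesgue_on cell. u x * \<phi> x\<bar> \<le> B * (LINT x|lebesgue_on cell. \<phi> x)"
proof -
  have "\<bar>LINT x|lebesgue_on cell. u x * \<phi> x\<bar> \<le> (LINT x|lebesgue_on cell. \<bar>u x * \<phi> x\<bar>)"
    by (rule integral_abs_bound)
  also have "\<dots> \<le> (LINT x|lebesgue_on cell. B * \<phi> x)"
  proof (rule integral_mono_AE)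
    show "AE x in lebesgue_on cell. \<bar>u x * \<phi> x\<bar> \<le> B * \<phi> x"
      using u(2) by eventually_elim (use \<phi>(2) in \<open>auto simp: abs_mult intro!: mult_right_mono\<close>)
  qed (use integrable_mult_continuous[OF u(1) \<phi>(1)] continuous_integrable_cell[OF \<phi>(1)] in auto)
  finally show ?thesis by simp
qed

text \<open>A distribution is encoded as a bare map, so homogeneity enters as an assumption. It
  suffices because two derivatives along one axis turn \<open>hart k\<close> into a multiple of
  itself. The factor \<open>c\<close> allows the formula to be applied again for the
  bilaplacian.\<close>

lemma laplacian_hart:
  assumes "\<And>c \<phi>. T (\<lambda>x. c * \<phi> x) = c * T \<phi>"
  shows "laplacian T (\<lambda>x. c * hart k x) = - (freq k \<bullet> freq k) * (c * T (hart k))"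
proof -
  have "laplacian T (\<lambda>x. c * hart k x) = (\<Sum>i\<in>UNIV. T (\<lambda>x. (c * of_int (k $ i) * of_int ((- k) $ i)) * hart (- (- k)) x))"
    by (simp only: laplacian_def dist_deriv_def partial_deriv_hart minus_minus)
  also have "\<dots> = (\<Sum>i\<in>UNIV. (c * of_int (k $ i) * of_int ((- k) $ i)) * T (hart k))"
    unfolding minus_minus by (simp only: assms)
  also have "\<dots> = - (freq k \<bullet> freq k) * (c * T (hart k))"
    by (simp add: inner_vec_def sum_distrib_right sum_distrib_left sum_negf mult_ac)
  finally show ?thesis .
qed

lemma regular_cmult: "regular u (\<lambda>x. c * \<phi> x) = c * regular u \<phi>"
  by (simp add: regular_def mult.left_commute[of _ c])

lemma laplacian_cmult:
  assumes "\<And>c \<phi>. T (\<lambda>x. c * \<phi> x) = c * T \<phi>"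
  shows "laplacian T (hart k) = - (freq k \<bullet> freq k) * T (hart k)"
    "laplacian (laplacian T) (hart k) = (freq k \<bullet> freq k)\<^sup>2 * T (hart k)"
proof -
  show *: "laplacian T (hart k) = - (freq k \<bullet> freq k) * T (hart k)"
    using laplacian_hart[of T 1 k, OF assms] by simp
  have pd: "partial_deriv i (hart k) = (\<lambda>x. of_int (k $ i) * hart (- k) x)" for i
    using partial_deriv_hart[where c=1 and k=k] by simp
  have "laplacian (laplacian T) (hart k) = (\<Sum>i\<in>UNIV. laplacian T (\<lambda>x. (of_int (k $ i) * of_int ((- k) $ i)) * hart (- (- k)) x))"
    by (simp only: laplacian_def[of "laplacian T"] dist_deriv_def pd partial_deriv_hart minus_minus)
  also have "\<dots> = (\<Sum>i\<in>UNIV. - (freq k \<bullet> freq k) * ((of_int (k $ i) * of_int ((- k) $ i)) * T (hart k)))"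
    by (simp only: laplacian_hart[OF assms] minus_minus)
  also have "\<dots> = (freq k \<bullet> freq k)\<^sup>2 * T (hart k)"
    by (simp add: inner_vec_def sum_distrib_right sum_distrib_left sum_negf power2_eq_square mult_ac)
  finally show "laplacian (laplacian T) (hart k) = (freq k \<bullet> freq k)\<^sup>2 * T (hart k)" .
qed

lemma regular_hart: "regular u (hart k) = torus.coef u k"
  by (simp add: regular_def torus.coef_def)

lemma coef_L1_diff:
  assumes "integrable (lebesgue_on cell) u" "integrable (lebesgue_on cell) v"
  shows "torus.coef (\<lambda>x. u x - v x) k = torus.coef u k - torus.coef v k"
  using assms by (simp add: torus.coef_def left_diff_distrib integrable_mult_continuous continuous_hart)

text \<open>The scheme tested with \<open>hart k\<close>, arranged as minus
  \<open>freq k \<bullet> freq k\<close> times the coefficient of the chemical potential.\<close>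

lemma scheme_step_coef:
  assumes "scheme_step \<nu> \<tau> A v w"
  shows "(torus.coef w k - torus.coef v k) / \<tau> =
    - (freq k \<bullet> freq k) * (\<nu> * (freq k \<bullet> freq k) * torus.coef w k + A * (torus.coef w k - torus.coef v k)
       + torus.coef (\<lambda>x. f_pot (v x)) k)"
proof -
  have int: "integrable (lebesgue_on cell) v" "integrable (lebesgue_on cell) w"
    using assms by (auto simp: scheme_step_def torus_L1_def)
  have div: "torus.coef (\<lambda>x. (w x - v x) / \<tau>) k = torus.coef (\<lambda>x. w x - v x) k / \<tau>"
    by (simp add: torus.coef_def)
  have "regular (\<lambda>x. (w x - v x) / \<tau>) (hart k) =
          - \<nu> * laplacian (laplacian (regular w)) (hart k)
          + A * laplacian (regular (\<lambda>x. w x - v x)) (hart k)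
          + laplacian (regular (\<lambda>x. f_pot (v x))) (hart k)"
    using assms test_fun_hart by (auto simp: scheme_step_def)
  then show ?thesis
    unfolding laplacian_cmult[OF regular_cmult] regular_hart div coef_L1_diff[OF int(2,1)] power2_eq_square
    by (simp only: algebra_simps)
qed

section \<open>Factorization of the symbol and bounds for the cubic\<close>

lemma symbol_factorization:
  fixes \<nu> \<tau> A :: real
  assumes "\<nu> > 0" "\<tau> > 0" "A \<ge> 1 + 2 * sqrt (1 + 4 / 3 * (\<nu> / \<tau>))"
  obtains a b where "a > 0" "b > 0" "a + b = A * \<tau>" "a * b = \<nu> * \<tau>" "3 / 4 * \<tau> * (A + 1) \<le> a"
proof -
  define m where "m = \<nu> / \<tau>"
  have m: "m > 0" using assms by (simp add: m_def)
  have "1 \<le> sqrt (1 + 4 / 3 * m)" using m by simp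
  then have A3: "A \<ge> 3" using assms(3) unfolding m_def by linarith
  have "(2 * sqrt (1 + 4 / 3 * m))\<^sup>2 \<le> (A - 1)\<^sup>2"
    using assms(3) m by (intro power_mono) (auto simp: m_def)
  \<comment> \<open>Multiplied out, this is the same inequality as \<open>disc\<close>, and
    \<open>disc\<close> says \<open>(A + 3) / 2 \<le> D\<close>, which is the bound
    \<open>3 / 4 * \<tau> * (A + 1) \<le> a\<close> for the larger root. This is where the threshold
    on \<open>A\<close> comes from.\<close>
  then have sq: "4 + 16 / 3 * m \<le> (A - 1)\<^sup>2"
    using m by (simp add: power_mult_distrib)
  then have disc: "((A + 3) / 2)\<^sup>2 \<le> A\<^sup>2 - 4 * m"
    by (simp add: power2_eq_square field_simps)
  define D where "D = sqrt (A\<^sup>2 - 4 * m)"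
  have nn: "A\<^sup>2 - 4 * m \<ge> 0" using disc by (smt (verit) zero_le_power2)
  have D2: "D\<^sup>2 = A\<^sup>2 - 4 * m" using nn by (simp add: D_def)
  have D1: "(A + 3) / 2 \<le> D"
    unfolding D_def using disc by (rule real_le_rsqrt)
  have "D < A"
    unfolding D_def using m A3 by (intro real_less_lsqrt) auto
  show thesis
  proof
    \<comment> \<open>The witnesses are the roots of
      \<open>t\<^sup>2 - A * \<tau> * t + \<nu> * \<tau>\<close>, with the larger one as
      \<open>a\<close>.\<close>
    show "\<tau> * (A + D) / 2 > 0" using A3 D1 assms by simp
    show "\<tau> * (A - D) / 2 > 0" using \<open>D < A\<close> assms by simp
    show "\<tau> * (A + D) / 2 + \<tau> * (A - D) / 2 = A * \<tau>" by (simp add: field_simps)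
    have "(\<tau> * (A + D) / 2) * (\<tau> * (A - D) / 2) = \<tau>\<^sup>2 * (A\<^sup>2 - D\<^sup>2) / 4"
      by (simp add: power2_eq_square algebra_simps)
    also have "\<dots> = \<tau> * (\<tau> * m)"
      unfolding D2 by (simp add: power2_eq_square)
    also have "\<dots> = \<nu> * \<tau>"
      using assms by (simp add: m_def)
    finally show "(\<tau> * (A + D) / 2) * (\<tau> * (A - D) / 2) = \<nu> * \<tau>" .
    have "\<tau> * (3 / 4 * (A + 1)) \<le> \<tau> * ((A + D) / 2)"
      using D1 assms by (intro mult_left_mono) auto
    then show "3 / 4 * \<tau> * (A + 1) \<le> \<tau> * (A + D) / 2" by (simp add: algebra_simps)
  qed
qed

text \<open>By the relation between \<open>M\<close> and \<open>A\<close>, the derivative of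
  \<open>g\<close> vanishes at \<open>M\<close>; hence \<open>g M - g s\<close> has the double
  factor \<open>(M - s)\<^sup>2\<close>, with cofactor \<open>2 * M + s \<ge> 0\<close>. Since
  \<open>g\<close> is odd, upper bounds for \<open>s\<close> and \<open>- s\<close> give the
  absolute values.\<close>

lemma cubic_bounds:
  fixes A c M s :: real
  defines "g \<equiv> \<lambda>s. A * s - f_pot s"
  assumes M: "M \<ge> 0" "3 * M\<^sup>2 = A + 1" and c: "c \<ge> 0" "c * (A + 1) \<le> 4 / 3" and s: "\<bar>s\<bar> \<le> M"
  shows "\<bar>g s\<bar> \<le> g M" "\<bar>s - c * g s\<bar> \<le> M - c * g M"
proof -
  have A: "A = 3 * M\<^sup>2 - 1" using M(2) by simp
  have diff: "g M - g s = (M - s)\<^sup>2 * (2 * M + s)" for s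
    by (simp add: g_def A f_pot_def power2_eq_square power3_eq_cube algebra_simps)
  have odd: "g (- s) = - g s" for s
    by (simp add: g_def f_pot_def)
  have 1: "g s \<le> g M" if "\<bar>s\<bar> \<le> M" for s
  proof -
    have "0 \<le> (M - s)\<^sup>2 * (2 * M + s)"
      using that M(1) by (intro mult_nonneg_nonneg) auto
    with diff[of s] show ?thesis by simp
  qed
  have 2: "s - c * g s \<le> M - c * g M" if "\<bar>s\<bar> \<le> M" for s
  proof -
    \<comment> \<open>Completing the square: the maximum is at \<open>s = - M / 2\<close>. As
      \<open>9 / 4 * M\<^sup>2 = 3 / 4 * (A + 1)\<close>, the condition
      \<open>c * (A + 1) \<le> 4 / 3\<close> is what bounds the product with \<open>c\<close> by
      1.\<close>
    have "(M - s) * (2 * M + s) \<le> 9 / 4 * M\<^sup>2"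
      using zero_le_power2[of "s + M / 2"] by (simp add: power2_eq_square algebra_simps)
    then have "c * ((M - s) * (2 * M + s)) \<le> c * (9 / 4 * M\<^sup>2)"
      using c(1) by (rule mult_left_mono)
    also have "\<dots> = 3 / 4 * (c * (A + 1))"
      by (simp add: A)
    also have "\<dots> \<le> 1" using c(2) by simp
    finally have "0 \<le> (M - s) * (1 - c * ((M - s) * (2 * M + s)))"
      using that by (intro mult_nonneg_nonneg) auto
    also have "\<dots> = (M - s) - c * (g M - g s)"
      unfolding diff by (simp add: power2_eq_square algebra_simps)
    finally show ?thesis by (simp add: algebra_simps)
  qed
  show "\<bar>g s\<bar> \<le> g M"
    using 1[of s] 1[of "- s"] s by (auto simp: odd abs_le_iff)
  show "\<bar>s - c * g s\<bar> \<le> M - c * g M"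
    using 2[of s] 2[of "- s"] s by (auto simp: odd abs_le_iff)
qed

text \<open>The two parts of \<open>w\<close> are controlled by \<open>M - c * g M\<close> and
  \<open>c * g M\<close>, which add up to exactly \<open>M\<close>, because the resolvents keep test
  functions nonnegative and preserve their integrals.\<close>

lemma scheme_step_max_principle:
  fixes v w :: "real ^ 'd \<Rightarrow> real"
  assumes pos: "\<nu> > 0" "\<tau> > 0" and A: "A \<ge> 1 + 2 * sqrt (1 + 4 / 3 * (\<nu> / \<tau>))"
    and step: "scheme_step \<nu> \<tau> A v w"
    and v: "AE x in lebesgue_on cell. \<bar>v x\<bar> \<le> sqrt ((A + 1) / 3)"
  shows "AE x in lebesgue_on cell. \<bar>w x\<bar> \<le> sqrt ((A + 1) / 3)"
proof -
  let ?M = "lebesgue_on (cell :: (real ^ 'd) set)"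
  define M where "M = sqrt ((A + 1) / 3)"
  have "0 \<le> sqrt (1 + 4 / 3 * (\<nu> / \<tau>))" using pos by simp
  then have A1: "A \<ge> 1" using A by linarith
  then have M: "M \<ge> 0" "3 * M\<^sup>2 = A + 1" by (auto simp: M_def)
  obtain a b where ab: "a > 0" "b > 0" "a + b = A * \<tau>" "a * b = \<nu> * \<tau>" "3 / 4 * \<tau> * (A + 1) \<le> a"
    using symbol_factorization[OF pos A] by blast
  define c where "c = \<tau> / a"
  have c: "c \<ge> 0" "c * (A + 1) \<le> 4 / 3" "c * a = \<tau>"
    using ab pos by (auto simp: c_def field_simps)
  define g where "g s = A * s - f_pot s" for s
  define G where "G x = A * v x - f_pot (v x)" for x
  define H where "H x = v x - c * G x" for x
  have int: "integrable ?M v" "integrable ?M w" "integrable ?M (\<lambda>x. f_pot (v x))"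
    using step by (auto simp: scheme_step_def torus_L1_def)
  have intG: "integrable ?M G" and intH: "integrable ?M H"
    using int by (auto simp: G_def[abs_def] H_def[abs_def])
  have bG: "AE x in ?M. \<bar>G x\<bar> \<le> g M" and bH: "AE x in ?M. \<bar>H x\<bar> \<le> M - c * g M"
    using v unfolding M_def[symmetric] atomize_conj AE_conj_iff[symmetric]
    by eventually_elim (use cubic_bounds[OF M c(1,2)] in \<open>auto simp: G_def H_def g_def\<close>)
  have coefG: "torus.coef G k = A * torus.coef v k - torus.coef (\<lambda>x. f_pot (v x)) k" for k
    using int unfolding G_def[abs_def] by (simp add: coef_L1_diff torus.coef_cmult)
  have coefH: "torus.coef H k = torus.coef v k - c * torus.coef G k" for k
    using int intG unfolding H_def[abs_def] by (simp add: coef_L1_diff torus.coef_cmult)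
  have lam: "1 + a * (freq k \<bullet> freq k) > 0" "1 + b * (freq k \<bullet> freq k) > 0" for k :: "int ^ 'd"
    using ab(1,2) by (auto intro!: add_pos_nonneg)
  \<comment> \<open>Partial fractions: with \<open>v = H + c * G\<close> and
    \<open>c * a = \<tau>\<close>, the right side of the scheme becomes
    \<open>H + c * (1 + a * l) * G\<close>, whose second term cancels the first factor of the
    symbol.\<close>
  have coefw: "torus.coef w k = torus.coef H k / (1 + a * (freq k \<bullet> freq k)) / (1 + b * (freq k \<bullet> freq k))
      + c * (torus.coef G k / (1 + b * (freq k \<bullet> freq k)))" for k
  proof -
    let ?l = "freq k \<bullet> freq k"
    have "torus.coef w k - torus.coef v k =
      - \<tau> * ?l * (\<nu> * ?l * torus.coef w k + A * (torus.coef w k - torus.coef v k) + torus.coef (\<lambda>x. f_pot (v x)) k)"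
      using scheme_step_coef[OF step, of k] pos by (simp add: field_simps)
    then have "(1 + (A * \<tau>) * ?l + (\<nu> * \<tau>) * ?l\<^sup>2) * torus.coef w k = torus.coef v k + \<tau> * ?l * torus.coef G k"
      unfolding coefG by (simp add: algebra_simps power2_eq_square)
    then have "(1 + a * ?l) * (1 + b * ?l) * torus.coef w k = torus.coef v k + (c * a) * ?l * torus.coef G k"
      unfolding ab(3)[symmetric] ab(4)[symmetric] c(3) by (simp add: algebra_simps power2_eq_square)
    then have "(1 + a * ?l) * (1 + b * ?l) * torus.coef w k = torus.coef H k + c * (1 + a * ?l) * torus.coef G k"
      unfolding coefH by (simp add: algebra_simps)
    then have "torus.coef w k = (torus.coef H k + c * (1 + a * ?l) * torus.coef G k) / ((1 + a * ?l) * (1 + b * ?l))"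
      using lam[of k] by (subst nonzero_eq_divide_eq) (simp_all add: mult.commute)
    also have "\<dots> = torus.coef H k / (1 + a * ?l) / (1 + b * ?l) + c * (torus.coef G k / (1 + b * ?l))"
      using lam[of k] by (simp add: add_divide_distrib)
    finally show ?thesis .
  qed
  have main: "\<bar>LINT x|?M. w x * \<psi> x\<bar> \<le> M * (LINT x|?M. \<psi> x)"
    if \<psi>: "\<psi> \<in> trig" "\<And>x. x \<in> cell \<Longrightarrow> 0 \<le> \<psi> x" for \<psi>
  proof -
    obtain K p where K: "finite K" "\<psi> = (\<lambda>x. \<Sum>k\<in>K. p k * hart k x)"
      using trig_expand[OF \<psi>(1)] by blast
    have nn: "0 \<le> (\<Sum>k\<in>K. p k * hart k x)" for x
    proof -
      obtain y where "y \<in> cell" "\<And>k. hart k x = hart k y"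
        using reduce_to_cell by blast
      with \<psi>(2)[of y] K show ?thesis by simp
    qed
    \<comment> \<open>The multipliers are moved from \<open>w\<close> to the test function:
      \<open>\<theta>\<close> is the resolvent with parameter \<open>b\<close> applied to
      \<open>\<psi>\<close>, and \<open>\<phi>\<close> the one with parameter \<open>a\<close>
      applied to \<open>\<theta>\<close>.\<close>
    define q where "q k = p k / (1 + b * (freq k \<bullet> freq k))" for k
    define r where "r k = q k / (1 + a * (freq k \<bullet> freq k))" for k
    define \<theta> where "\<theta> x = (\<Sum>k\<in>K. q k * hart k x)" for x
    define \<phi> where "\<phi> x = (\<Sum>k\<in>K. r k * hart k x)" for x
    have \<theta>0: "0 \<le> \<theta> x" for x
      unfolding \<theta>_def q_def using K(1) ab(2) nn by (rule resolvent_nonneg)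
    have \<phi>0: "0 \<le> \<phi> x" for x
      unfolding \<phi>_def r_def using K(1) ab(1) \<theta>0[unfolded \<theta>_def] by (rule resolvent_nonneg)
    have \<theta>I: "(LINT x|?M. \<theta> x) = (LINT x|?M. \<psi> x)"
      using integral_trig_multiplier[of "\<lambda>k. 1 / (1 + b * (freq k \<bullet> freq k))" p K]
      unfolding \<theta>_def q_def K by simp
    have \<phi>I: "(LINT x|?M. \<phi> x) = (LINT x|?M. \<theta> x)"
      using integral_trig_multiplier[of "\<lambda>k. 1 / (1 + a * (freq k \<bullet> freq k))" q K]
      unfolding \<theta>_def \<phi>_def r_def by simp
    have cont: "continuous_on UNIV \<theta>" "continuous_on UNIV \<phi>"
      unfolding \<theta>_def[abs_def] \<phi>_def[abs_def] by (intro continuous_intros)+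
    have "(LINT x|?M. w x * \<psi> x) = (\<Sum>k\<in>K. r k * torus.coef H k + c * (q k * torus.coef G k))"
      unfolding K integral_mult_trig[OF int(2)] coefw r_def q_def
      by (intro sum.cong) (auto simp: field_simps)
    also have "\<dots> = (LINT x|?M. H x * \<phi> x) + c * (LINT x|?M. G x * \<theta> x)"
      unfolding \<phi>_def \<theta>_def integral_mult_trig[OF intH] integral_mult_trig[OF intG]
      by (simp add: sum.distrib sum_distrib_left)
    finally have eq: "(LINT x|?M. w x * \<psi> x) = (LINT x|?M. H x * \<phi> x) + c * (LINT x|?M. G x * \<theta> x)" .
    have "\<bar>LINT x|?M. w x * \<psi> x\<bar> \<le> \<bar>LINT x|?M. H x * \<phi> x\<bar> + c * \<bar>LINT x|?M. G x * \<theta> x\<bar>"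
      unfolding eq using c(1) abs_triangle_ineq[of "LINT x|?M. H x * \<phi> x" "c * (LINT x|?M. G x * \<theta> x)"]
      by (simp add: abs_mult)
    also have "\<dots> \<le> (M - c * g M) * (LINT x|?M. \<phi> x) + c * (g M * (LINT x|?M. \<theta> x))"
      by (intro add_mono mult_left_mono abs_integral_mult_le intH intG bH bG cont \<theta>0 \<phi>0 c)
    also have "\<dots> = M * (LINT x|?M. \<psi> x)"
      unfolding \<phi>I \<theta>I by (simp add: algebra_simps)
    finally show ?thesis .
  qed
  have half: "AE x in ?M. 0 \<le> M - s * w x" if s: "\<bar>s\<bar> = 1" for s
  proof (rule nonneg_if_trig_nonneg)
    show "integrable ?M (\<lambda>x. M - s * w x)"
      using int finite_measure.integrable_const[OF finite_measure_cell] by simp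
    fix \<psi> :: "real ^ 'd \<Rightarrow> real" assume \<psi>: "\<psi> \<in> trig" "\<And>x. x \<in> cell \<Longrightarrow> 0 \<le> \<psi> x"
    have "(LINT x|?M. (M - s * w x) * \<psi> x) = M * (LINT x|?M. \<psi> x) - s * (LINT x|?M. w x * \<psi> x)"
      using continuous_integrable_cell[OF continuous_trig[OF \<psi>(1)]]
        integrable_mult_continuous[OF int(2) continuous_trig[OF \<psi>(1)]]
      by (simp add: left_diff_distrib mult.assoc)
    moreover have "s * (LINT x|?M. w x * \<psi> x) \<le> \<bar>LINT x|?M. w x * \<psi> x\<bar>"
      using abs_ge_self[of "s * (LINT x|?M. w x * \<psi> x)"] s by (simp add: abs_mult)
    ultimately show "0 \<le> (LINT x|?M. (M - s * w x) * \<psi> x)"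
      using main[OF \<psi>] by linarith
  qed
  have "AE x in ?M. 0 \<le> M - 1 * w x" "AE x in ?M. 0 \<le> M - (- 1) * w x"
    by (rule half; simp)+
  then show ?thesis
    unfolding M_def[symmetric] by eventually_elim auto
qed

section \<open>Sobolev norms and the energy\<close>

lemma has_sum_swap_finite_sum:
  fixes f :: "'i \<Rightarrow> 'k \<Rightarrow> real"
  assumes "finite I" "\<And>i. i \<in> I \<Longrightarrow> (f i has_sum S i) A"
  shows "((\<lambda>k. \<Sum>i\<in>I. f i k) has_sum (\<Sum>i\<in>I. S i)) A"
  using assms by (induction I rule: finite_induct) (auto intro: has_sum_add)

text \<open>Undoes the reversal of frequencies caused by differentiating Hartley functions.\<close>

lemma has_sum_uminus_index:
  fixes f :: "int ^ 'd \<Rightarrow> real"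
  shows "((\<lambda>k. f (- k)) has_sum S) UNIV \<longleftrightarrow> (f has_sum S) UNIV"
  by (rule has_sum_reindex_bij_betw) (rule bij_uminus)

lemma test_fun_differentiable: "test_fun \<phi> \<Longrightarrow> \<phi> differentiable at x"
  unfolding test_fun_def by (metis foldr.simps(1) id_apply)

lemma test_fun_continuous: "test_fun \<phi> \<Longrightarrow> continuous_on S \<phi>"
  using test_fun_differentiable
  by (intro continuous_at_imp_continuous_on ballI differentiable_imp_continuous_within) blast

lemma test_fun_partial_deriv:
  fixes \<phi> :: "real ^ 'd \<Rightarrow> real"
  assumes "test_fun \<phi>"
  shows "test_fun (partial_deriv i \<phi>)"
  unfolding test_fun_def
proof (intro conjI allI)
  have per: "periodic \<phi>" using assms by (simp add: test_fun_def)
  show "periodic (partial_deriv i \<phi>)"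
    unfolding periodic_def
  proof (intro allI)
    fix j :: 'd and x :: "real ^ 'd"
    let ?p = "(2 * pi) *\<^sub>R axis j (1 :: real)"
    have "(\<phi> has_derivative frechet_derivative \<phi> (at (x + ?p))) (at (x + ?p))"
      using test_fun_differentiable[OF assms] frechet_derivative_works by blast
    moreover have "((\<lambda>x. x + ?p) has_derivative (\<lambda>h. h)) (at x)"
      by (auto intro!: derivative_eq_intros)
    ultimately have "((\<lambda>x. \<phi> (x + ?p)) has_derivative frechet_derivative \<phi> (at (x + ?p))) (at x)"
      by (rule has_derivative_compose[rotated])
    moreover have "(\<lambda>x. \<phi> (x + ?p)) = \<phi>"
      using per by (auto simp: periodic_def)
    ultimately show "partial_deriv i \<phi> (x + ?p) = partial_deriv i \<phi> x"
      using partial_deriv_eq by (fastforce simp: partial_deriv_def)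
  qed
  show "foldr partial_deriv is (partial_deriv i \<phi>) differentiable at x" for "is" x
    using assms foldr_append[of partial_deriv "is" "[i]" \<phi>] unfolding test_fun_def
    by (metis foldr.simps comp_apply id_apply)
qed

lemma test_fun_square_integrable: "test_fun \<phi> \<Longrightarrow> square_integrable (lebesgue_on cell) \<phi>"
  by (intro continuous_square_integrable_cell test_fun_continuous)

text \<open>Integration by parts: the partial derivative of the periodic product
  \<open>\<phi> x * hart k x\<close> has integral zero.\<close>

lemma coef_partial_deriv:
  fixes \<phi> :: "real ^ 'd \<Rightarrow> real"
  assumes "test_fun \<phi>"
  shows "torus.coef (partial_deriv j \<phi>) k = - of_int (k $ j) * torus.coef \<phi> (- k)"
proof -
  have c: "continuous_on UNIV \<phi>" "continuous_on UNIV (partial_deriv j \<phi>)"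
    using assms by (auto intro: test_fun_continuous test_fun_partial_deriv)
  have der: "((\<lambda>x. \<phi> x * hart k x) has_derivative
      (\<lambda>h. \<phi> x * ((freq k \<bullet> h) * hart (- k) x) + frechet_derivative \<phi> (at x) h * hart k x)) (at x)" for x
    using frechet_derivative_works[THEN iffD1, OF test_fun_differentiable[OF assms]]
    by (intro has_derivative_mult has_derivative_hart)
  have pd: "partial_deriv j (\<lambda>x. \<phi> x * hart k x)
      = (\<lambda>x. \<phi> x * (of_int (k $ j) * hart (- k) x) + partial_deriv j \<phi> x * hart k x)"
    by (auto simp: partial_deriv_eq[OF der] inner_axis partial_deriv_def)
  have "(LINT x|lebesgue_on cell. partial_deriv j (\<lambda>x. \<phi> x * hart k x) x) = 0"
  proof (rule integral_partial_deriv)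
    show "(\<lambda>x. \<phi> x * hart k x) differentiable at x" for x
      using der differentiableI by blast
    show "periodic (\<lambda>x. \<phi> x * hart k x)"
      using assms periodic_hart[of k] by (simp add: test_fun_def periodic_def)
    show "continuous_on UNIV (partial_deriv j (\<lambda>x. \<phi> x * hart k x))"
      unfolding pd by (intro continuous_intros c)
  qed
  moreover have "integrable (lebesgue_on cell) (\<lambda>x. of_int (k $ j) * (\<phi> x * hart (- k) x))"
    "integrable (lebesgue_on cell) (\<lambda>x. partial_deriv j \<phi> x * hart k x)"
    by (intro continuous_integrable_cell continuous_intros c)+
  ultimately have "of_int (k $ j) * torus.coef \<phi> (- k) + torus.coef (partial_deriv j \<phi>) k = 0"
    unfolding pd torus.coef_def
    by (simp add: mult.left_commute[of _ "of_int (k $ j)"])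
  then show ?thesis by simp
qed

lemma coef_hart: "torus.coef (\<lambda>x. c * hart m x) k = (if k = m then c else 0)"
  by (simp add: torus.coef_cmult) (simp add: torus.coef_def integral_hart_mult)

text \<open>Parseval's formula taken as the meaning of a Fourier series of a distribution. It covers
  the chemical potential, whose Laplacian term is given only through its action on test functions;
  convergence is asked for each test function separately.\<close>

definition fourier_repr :: "'d::finite distribution \<Rightarrow> (int ^ 'd \<Rightarrow> real) \<Rightarrow> bool" where
  "fourier_repr T t \<longleftrightarrow> (\<forall>\<phi>. test_fun \<phi> \<longrightarrow> ((\<lambda>k. t k * torus.coef \<phi> k) has_sum T \<phi>) UNIV)"

lemma fourier_repr_regular:
  "square_integrable (lebesgue_on cell) u \<Longrightarrow> fourier_repr (regular u) (torus.coef u)"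
  unfolding fourier_repr_def regular_def
  by (auto intro: torus.parseval test_fun_square_integrable)

lemma fourier_repr_laplacian:
  assumes "fourier_repr T t"
  shows "fourier_repr (laplacian T) (\<lambda>k. - (freq k \<bullet> freq k) * t k)"
  unfolding fourier_repr_def
proof (intro allI impI)
  fix \<phi> :: "real ^ 'a \<Rightarrow> real" assume \<phi>: "test_fun \<phi>"
  have "((\<lambda>k. \<Sum>i\<in>UNIV. t k * torus.coef (partial_deriv i (partial_deriv i \<phi>)) k) has_sum
      (\<Sum>i\<in>UNIV. T (partial_deriv i (partial_deriv i \<phi>)))) UNIV"
    using assms \<phi> by (intro has_sum_swap_finite_sum) (auto simp: fourier_repr_def test_fun_partial_deriv)
  also have "(\<lambda>k. \<Sum>i\<in>UNIV. t k * torus.coef (partial_deriv i (partial_deriv i \<phi>)) k)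
      = (\<lambda>k. - (freq k \<bullet> freq k) * t k * torus.coef \<phi> k)"
    using \<phi> by (simp add: coef_partial_deriv test_fun_partial_deriv inner_vec_def
        sum_distrib_left sum_distrib_right sum_negf mult_ac)
  finally show "((\<lambda>k. - (freq k \<bullet> freq k) * t k * torus.coef \<phi> k) has_sum laplacian T \<phi>) UNIV"
    by (simp add: laplacian_def dist_deriv_def)
qed

lemma fourier_repr_partial_deriv_hart:
  assumes "fourier_repr T t"
  shows "T (partial_deriv j (hart k)) = of_int (k $ j) * t (- k)"
proof -
  have pd: "partial_deriv j (hart k) = (\<lambda>x. of_int (k $ j) * hart (- k) x)"
    using partial_deriv_hart[where c=1 and k=k] by simp
  have "((\<lambda>l. t l * torus.coef (partial_deriv j (hart k)) l) has_sum T (partial_deriv j (hart k))) UNIV"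
    using assms test_fun_partial_deriv[OF test_fun_hart] by (auto simp: fourier_repr_def)
  moreover have "((\<lambda>l. t l * torus.coef (partial_deriv j (hart k)) l) has_sum of_int (k $ j) * t (- k)) UNIV"
    by (rule has_sum_finite_neutralI[where B="{- k}"]) (auto simp: pd coef_hart)
  ultimately show ?thesis by (rule has_sum_unique)
qed

section \<open>Square integrable gradients and their Fourier series\<close>

lemma norm_vec_sq: "(norm (x :: real ^ 'd))\<^sup>2 = (\<Sum>i\<in>UNIV. (x $ i)\<^sup>2)"
  unfolding power2_norm_eq_inner inner_vec_def by (simp add: power2_eq_square)

lemma in_L2_components:
  fixes g :: "real ^ 'd \<Rightarrow> real ^ 'd"
  assumes "in_L2 g"
  shows "square_integrable (lebesgue_on cell) (\<lambda>x. g x $ i)"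
    and "L2_norm_sq g = ennreal (\<Sum>i\<in>UNIV. LINT x|lebesgue_on cell. (g x $ i)\<^sup>2)"
    and "integrable (lebesgue_on cell) (\<lambda>x. (norm (g x))\<^sup>2)"
    and "(LINT x|lebesgue_on cell. (norm (g x))\<^sup>2) = (\<Sum>i\<in>UNIV. LINT x|lebesgue_on cell. (g x $ i)\<^sup>2)"
proof -
  have gm [measurable]: "g \<in> borel_measurable (lebesgue_on cell)"
    and fin: "L2_norm_sq g < \<infinity>"
    using assms by (auto simp: in_L2_def)
  have [measurable]: "(\<lambda>x. g x $ i) \<in> borel_measurable (lebesgue_on cell)" for i
    by (rule measurable_compose[OF gm borel_measurable_continuous_onI]) (intro continuous_intros)
  show int: "integrable (lebesgue_on cell) (\<lambda>x. (norm (g x))\<^sup>2)"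
    using fin by (intro integrableI_bounded) (auto simp: L2_norm_sq_def)
  have comp: "(g x $ i)\<^sup>2 \<le> (norm (g x))\<^sup>2" for x i
    using component_le_norm_cart[of "g x" i] by (simp add: abs_le_square_iff[symmetric])
  show sq: "square_integrable (lebesgue_on cell) (\<lambda>x. g x $ i)" for i
    unfolding square_integrable_def
    by (intro conjI Bochner_Integration.integrable_bound[OF int]) (auto simp: comp)
  show eq: "(LINT x|lebesgue_on cell. (norm (g x))\<^sup>2) = (\<Sum>i\<in>UNIV. LINT x|lebesgue_on cell. (g x $ i)\<^sup>2)"
    unfolding norm_vec_sq using sq by (intro Bochner_Integration.integral_sum) (auto simp: square_integrable_def)
  show "L2_norm_sq g = ennreal (\<Sum>i\<in>UNIV. LINT x|lebesgue_on cell. (g x $ i)\<^sup>2)"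
    unfolding L2_norm_sq_def eq[symmetric] using int by (intro nn_integral_eq_integral) auto
qed

text \<open>Testing with \<open>hart k\<close> determines all coefficients of every component of an
  L2 gradient, so the value is the same for whichever representative \<open>gradient\<close>
  selects.\<close>

lemma L2_gradient_has_sum:
  fixes g :: "real ^ 'd \<Rightarrow> real ^ 'd"
  assumes T: "fourier_repr T t" and g: "has_L2_gradient T g"
  shows "((\<lambda>k. (freq k \<bullet> freq k) * (t k)\<^sup>2) has_sum (LINT x|lebesgue_on cell. (norm (g x))\<^sup>2)) UNIV"
proof -
  have L2: "in_L2 g" using g by (simp add: has_L2_gradient_def)
  have coef: "torus.coef (\<lambda>x. g x $ i) k = - of_int (k $ i) * t (- k)" for i k
  proof -
    have "dist_deriv i T (hart k) = regular (\<lambda>x. g x $ i) (hart k)"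
      using g test_fun_hart by (auto simp: has_L2_gradient_def)
    then show ?thesis
      by (simp add: dist_deriv_def fourier_repr_partial_deriv_hart[OF T] regular_hart)
  qed
  have "((\<lambda>k. \<Sum>i\<in>UNIV. (torus.coef (\<lambda>x. g x $ i) k)\<^sup>2) has_sum (\<Sum>i\<in>UNIV. LINT x|lebesgue_on cell. (g x $ i)\<^sup>2)) UNIV"
    by (intro has_sum_swap_finite_sum torus.parseval_norm in_L2_components[OF L2]) auto
  also have "(\<lambda>k. \<Sum>i\<in>UNIV. (torus.coef (\<lambda>x. g x $ i) k)\<^sup>2)
      = (\<lambda>k. (freq (- k) \<bullet> freq (- k)) * (t (- k))\<^sup>2)"
    by (simp add: coef inner_vec_def sum_distrib_right power_mult_distrib) (simp add: power2_eq_square)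
  finally show ?thesis
    unfolding has_sum_uminus_index[of "\<lambda>k. (freq k \<bullet> freq k) * (t k)\<^sup>2"] in_L2_components(4)[OF L2] .
qed

text \<open>Riesz-Fischer builds each component from the coefficients it must have; they are square
  summable because the square of one component of \<open>k\<close> is at most
  \<open>freq k \<bullet> freq k\<close>. Parseval then confirms the weak derivative on every test
  function.\<close>

lemma L2_gradient_exists:
  fixes T :: "'d::finite distribution"
  assumes T: "fourier_repr T t" and sum: "(\<lambda>k. (freq k \<bullet> freq k) * (t k)\<^sup>2) summable_on UNIV"
  shows "\<exists>g. has_L2_gradient T g"
proof -
  have sum': "(\<lambda>k. (freq k \<bullet> freq k) * (t (- k))\<^sup>2) summable_on UNIV"
  proof -
    obtain S where "((\<lambda>k. (freq k \<bullet> freq k) * (t k)\<^sup>2) has_sum S) UNIV"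
      using sum by (auto simp: summable_on_def)
    then have "((\<lambda>k. (freq (- k) \<bullet> freq (- k)) * (t (- k))\<^sup>2) has_sum S) UNIV"
      unfolding has_sum_uminus_index[of "\<lambda>k. (freq k \<bullet> freq k) * (t k)\<^sup>2"] .
    then show ?thesis by (auto simp: summable_on_def)
  qed
  have comp: "(of_int (k $ i))\<^sup>2 \<le> freq k \<bullet> freq k" for k :: "int ^ 'd" and i
    using power_mono[OF component_le_norm_cart abs_ge_zero, of "freq k" i 2]
    by (simp add: power2_norm_eq_inner)
  have "\<exists>f. square_integrable (lebesgue_on cell) f \<and> (\<forall>k. torus.coef f k = - of_int (k $ i) * t (- k))" for i
  proof -
    have "(\<lambda>k. (- of_int (k $ i) * t (- k))\<^sup>2) summable_on UNIV"
      by (rule summable_on_comparison_test[OF sum'])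
         (auto simp: power_mult_distrib comp intro: mult_right_mono)
    from torus.riesz_fischer[OF this] show ?thesis by blast
  qed
  then obtain G where G: "\<And>i. square_integrable (lebesgue_on cell) (G i)"
    "\<And>i k. torus.coef (G i) k = - of_int (k $ i) * t (- k)"
    by metis
  define g where "g x = (\<chi> i. G i x)" for x
  have [measurable]: "G i \<in> borel_measurable (lebesgue_on cell)" for i
    using G(1) by (simp add: square_integrable_def)
  have gm: "g \<in> borel_measurable (lebesgue_on cell)"
    by (subst borel_measurable_euclidean_space) (auto simp: Basis_vec_def inner_axis g_def)
  have "L2_norm_sq g = (\<integral>\<^sup>+x. ennreal (\<Sum>i\<in>UNIV. (G i x)\<^sup>2) \<partial>lebesgue_on cell)"
    by (simp add: L2_norm_sq_def g_def norm_vec_sq)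
  also have "\<dots> = ennreal (LINT x|lebesgue_on cell. (\<Sum>i\<in>UNIV. (G i x)\<^sup>2))"
    using G(1) by (intro nn_integral_eq_integral) (auto simp: square_integrable_def sum_nonneg)
  also have "\<dots> < \<infinity>" by simp
  finally have "in_L2 g" using gm by (simp add: in_L2_def)
  moreover have "dist_deriv i T \<phi> = regular (\<lambda>x. g x $ i) \<phi>" if \<phi>: "test_fun \<phi>" for \<phi> i
  proof -
    have "((\<lambda>k. torus.coef (G i) k * torus.coef \<phi> k) has_sum regular (G i) \<phi>) UNIV"
      unfolding regular_def by (intro torus.parseval G test_fun_square_integrable \<phi>)
    then have "((\<lambda>k. - t (- k) * (of_int (k $ i) * torus.coef \<phi> k)) has_sum regular (G i) \<phi>) UNIV"
      by (simp add: G(2) mult_ac)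
    then have "((\<lambda>k. - t (- (- k)) * (of_int ((- k) $ i) * torus.coef \<phi> (- k))) has_sum regular (G i) \<phi>) UNIV"
      unfolding has_sum_uminus_index[of "\<lambda>k. - t (- k) * (of_int (k $ i) * torus.coef \<phi> k)"] .
    then have "((\<lambda>k. - (t k * torus.coef (partial_deriv i \<phi>) k)) has_sum regular (G i) \<phi>) UNIV"
      by (simp add: coef_partial_deriv[OF \<phi>])
    moreover have "((\<lambda>k. - (t k * torus.coef (partial_deriv i \<phi>) k)) has_sum - T (partial_deriv i \<phi>)) UNIV"
      using T test_fun_partial_deriv[OF \<phi>] by (intro has_sum_uminusI) (auto simp: fourier_repr_def)
    ultimately have "regular (G i) \<phi> = - T (partial_deriv i \<phi>)"
      by (rule has_sum_unique)
    then show ?thesis by (simp add: dist_deriv_def g_def)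
  qed
  ultimately have "has_L2_gradient T g"
    by (simp add: has_L2_gradient_def)
  then show ?thesis by blast
qed

lemma gradient_norm_sq_eq:
  assumes T: "fourier_repr T t" and sum: "((\<lambda>k. (freq k \<bullet> freq k) * (t k)\<^sup>2) has_sum S) UNIV"
  shows "gradient_norm_sq T = ennreal S"
proof -
  have ex: "\<exists>g. has_L2_gradient T g"
    using L2_gradient_exists[OF T] sum by (auto simp: summable_on_def)
  then have grad: "has_L2_gradient T (gradient T)"
    unfolding gradient_def by (rule someI_ex)
  then have L2: "in_L2 (gradient T)" by (simp add: has_L2_gradient_def)
  have "(LINT x|lebesgue_on cell. (norm (gradient T x))\<^sup>2) = S"
    using L2_gradient_has_sum[OF T grad] sum by (rule has_sum_unique)
  then show ?thesis
    using ex in_L2_components(2,4)[OF L2] by (simp add: gradient_norm_sq_def)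
qed

section \<open>The energy in terms of Fourier coefficients\<close>

lemma L2_norm_sq_real:
  fixes u :: "real ^ 'd \<Rightarrow> real"
  assumes "square_integrable (lebesgue_on cell) u"
  shows "L2_norm_sq u = ennreal (LINT x|lebesgue_on cell. (u x)\<^sup>2)"
  using assms unfolding L2_norm_sq_def square_integrable_def
  by (subst nn_integral_eq_integral) auto

lemma integrable_F_pot:
  fixes u :: "real ^ 'd \<Rightarrow> real"
  assumes "u \<in> borel_measurable (lebesgue_on cell)" "AE x in lebesgue_on cell. \<bar>u x\<bar> \<le> B"
  shows "integrable (lebesgue_on cell) (\<lambda>x. F_pot (u x))"
proof -
  have "square_integrable (lebesgue_on cell) (\<lambda>x. (u x)\<^sup>2 - 1)"
  proof (rule finite_measure.square_integrable_bounded[OF finite_measure_cell])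
    show "AE x in lebesgue_on cell. \<bar>(u x)\<^sup>2 - 1\<bar> \<le> B\<^sup>2 + 1"
      using assms(2)
    proof eventually_elim
      case (elim x)
      then have "(u x)\<^sup>2 \<le> B\<^sup>2" by (simp add: abs_le_square_iff[symmetric])
      then show ?case using zero_le_power2[of "u x"] by linarith
    qed
  qed (use assms in auto)
  then show ?thesis
    by (simp add: square_integrable_def F_pot_def)
qed

text \<open>The bound on \<open>u\<close> makes the potential part integrable, so the
  extended-valued energy reduces to a real number.\<close>

lemma energy_eq:
  fixes u :: "real ^ 'd \<Rightarrow> real"
  assumes \<nu>: "\<nu> > 0"
    and u: "u \<in> borel_measurable (lebesgue_on cell)" "AE x in lebesgue_on cell. \<bar>u x\<bar> \<le> B"
    and sum: "((\<lambda>k. (freq k \<bullet> freq k) * (torus.coef u k)\<^sup>2) has_sum S) UNIV"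
  shows "energy \<nu> u = ennreal (\<nu> / 2 * S + (LINT x|lebesgue_on cell. F_pot (u x)))"
proof -
  have sq: "square_integrable (lebesgue_on cell) u"
    using finite_measure.square_integrable_bounded[OF finite_measure_cell u] .
  have T: "fourier_repr (regular u) (torus.coef u)"
    using sq by (rule fourier_repr_regular)
  have ex: "\<exists>g. has_L2_gradient (regular u) g"
    using L2_gradient_exists[OF T] sum by (auto simp: summable_on_def)
  then have grad: "has_L2_gradient (regular u) (gradient (regular u))"
    unfolding gradient_def by (rule someI_ex)
  then have L2: "in_L2 (gradient (regular u))" by (simp add: has_L2_gradient_def)
  have "in_H1 u"
    using ex u sq L2_norm_sq_real[OF sq] by (simp add: in_H1_def in_L2_def)
  have S: "(LINT x|lebesgue_on cell. (norm (gradient (regular u) x))\<^sup>2) = S"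
    using L2_gradient_has_sum[OF T grad] sum by (rule has_sum_unique)
  have int: "integrable (lebesgue_on cell) (\<lambda>x. 1 / 2 * \<nu> * (norm (gradient (regular u) x))\<^sup>2)"
    using in_L2_components(3)[OF L2] by simp
  have "energy \<nu> u = ennreal (LINT x|lebesgue_on cell. 1 / 2 * \<nu> * (norm (gradient (regular u) x))\<^sup>2 + F_pot (u x))"
    unfolding energy_def if_P[OF \<open>in_H1 u\<close>]
    using \<nu> int integrable_F_pot[OF u]
    by (intro nn_integral_eq_integral) (auto simp: F_pot_def)
  also have "(LINT x|lebesgue_on cell. 1 / 2 * \<nu> * (norm (gradient (regular u) x))\<^sup>2 + F_pot (u x))
      = \<nu> / 2 * S + (LINT x|lebesgue_on cell. F_pot (u x))"
    using int integrable_F_pot[OF u] by (simp add: S)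
  finally show ?thesis .
qed

section \<open>Energy dissipation in one step\<close>

lemma in_H1_has_sum:
  fixes u :: "real ^ 'd \<Rightarrow> real"
  assumes "in_H1 u" "square_integrable (lebesgue_on cell) u"
  obtains S where "((\<lambda>k. (freq k \<bullet> freq k) * (torus.coef u k)\<^sup>2) has_sum S) UNIV"
  using assms L2_gradient_has_sum[OF fourier_repr_regular] unfolding in_H1_def by blast

text \<open>As \<open>F_pot\<close> is quartic, the gap between the two sides is the explicit
  polynomial \<open>(6 * M\<^sup>2 - (3 * v\<^sup>2 + 2 * v * w + w\<^sup>2)) * (w - v)\<^sup>2 /
  4\<close>, nonnegative on \<open>[-M, M]\<close>.\<close>

lemma F_pot_increment:
  fixes v w M A :: real
  assumes "\<bar>v\<bar> \<le> M" "\<bar>w\<bar> \<le> M" "3 * M\<^sup>2 = A + 1"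
  shows "F_pot w - F_pot v \<le> (w - v) * f_pot v + A / 2 * (w - v)\<^sup>2"
proof -
  have "v\<^sup>2 \<le> M\<^sup>2" "w\<^sup>2 \<le> M\<^sup>2"
    using assms by (simp_all add: abs_le_square_iff[symmetric])
  moreover have "0 \<le> (v - w)\<^sup>2" by simp
  then have "2 * v * w \<le> v\<^sup>2 + w\<^sup>2" by (simp add: power2_diff)
  ultimately have "0 \<le> 6 * M\<^sup>2 - (3 * v\<^sup>2 + 2 * v * w + w\<^sup>2)" by linarith
  then have "0 \<le> (6 * M\<^sup>2 - (3 * v\<^sup>2 + 2 * v * w + w\<^sup>2)) * (w - v)\<^sup>2 / 4"
    by simp
  also have "\<dots> = (w - v) * f_pot v + A / 2 * (w - v)\<^sup>2 - (F_pot w - F_pot v)"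
  proof -
    have A: "A = 3 * M\<^sup>2 - 1" using assms(3) by simp
    show ?thesis unfolding A F_pot_def f_pot_def by algebra
  qed
  finally show ?thesis by simp
qed

text \<open>If \<open>v\<close> is not in H1, the right side is infinite. Otherwise the identity at
  each frequency bounds nonnegative terms by a summable family, which yields both the H1 regularity
  of \<open>w\<close> and the square integrable gradient of the chemical potential.\<close>

lemma scheme_step_energy:
  fixes v w :: "real ^ 'd \<Rightarrow> real"
  assumes pos: "\<nu> > 0" "\<tau> > 0" and M: "3 * M\<^sup>2 = A + 1" "A \<ge> 0"
    and step: "scheme_step \<nu> \<tau> A v w"
    and bv: "AE x in lebesgue_on cell. \<bar>v x\<bar> \<le> M" and bw: "AE x in lebesgue_on cell. \<bar>w x\<bar> \<le> M"
  shows "energy \<nu> w + ennreal (A / 2) * L2_norm_sq (\<lambda>x. w x - v x)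
      + ennreal \<tau> * gradient_norm_sq (chem_potential \<nu> A v w) \<le> energy \<nu> v"
proof (cases "in_H1 v")
  case False
  then show ?thesis by (simp add: energy_def)
next
  case True
  let ?M = "lebesgue_on (cell :: (real ^ 'd) set)"
  let ?f = "\<lambda>x. f_pot (v x)"
  let ?l = "\<lambda>k :: int ^ 'd. freq k \<bullet> freq k"
  let ?v = "torus.coef v" and ?w = "torus.coef w" and ?fv = "torus.coef ?f"
  note bounded = finite_measure.square_integrable_bounded[OF finite_measure_cell]
  have vm: "v \<in> borel_measurable ?M" "w \<in> borel_measurable ?M" "?f \<in> borel_measurable ?M"
    using step by (auto simp: scheme_step_def torus_L1_def)
  have sv: "square_integrable ?M v" and sw: "square_integrable ?M w"
    using bounded vm bv bw by auto
  have sf: "square_integrable ?M ?f"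
  proof (rule bounded[OF vm(3)])
    show "AE x in ?M. \<bar>?f x\<bar> \<le> M ^ 3 + M"
      using bv
    proof eventually_elim
      case (elim x)
      have "\<bar>?f x\<bar> \<le> \<bar>v x\<bar> ^ 3 + \<bar>v x\<bar>"
        unfolding f_pot_def power_abs[symmetric] by linarith
      also have "\<dots> \<le> M ^ 3 + M"
        using elim by (intro add_mono power_mono) auto
      finally show ?case .
    qed
  qed
  define d where "d x = w x - v x" for x
  have sd: "square_integrable ?M d"
    unfolding d_def[abs_def] by (intro square_integrable_diff sv sw)
  have coefd: "torus.coef d k = ?w k - ?v k" for k
    unfolding d_def[abs_def] by (rule torus.coef_diff[OF sw sv])
  \<comment> \<open>The Fourier coefficients of the chemical potential; with them the scheme reads
    \<open>torus.coef d k = - \<tau> * ?l k * t k\<close>.\<close>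
  define t where "t k = - \<nu> * (- ?l k * ?w k) + A * torus.coef d k + ?fv k" for k
  have T: "fourier_repr (chem_potential \<nu> A v w) t"
    unfolding fourier_repr_def
  proof (intro allI impI)
    fix \<phi> :: "real ^ 'd \<Rightarrow> real" assume \<phi>: "test_fun \<phi>"
    have "((\<lambda>k. - \<nu> * (- ?l k * ?w k * torus.coef \<phi> k) + A * (torus.coef d k * torus.coef \<phi> k) + ?fv k * torus.coef \<phi> k)
       has_sum - \<nu> * laplacian (regular w) \<phi> + A * regular d \<phi> + regular ?f \<phi>) UNIV"
      using \<phi> fourier_repr_laplacian[OF fourier_repr_regular[OF sw]] fourier_repr_regular[OF sd] fourier_repr_regular[OF sf]
      by (intro has_sum_add has_sum_cmult_right) (auto simp: fourier_repr_def)
    moreover have "(\<lambda>k. - \<nu> * (- ?l k * ?w k * torus.coef \<phi> k) + A * (torus.coef d k * torus.coef \<phi> k) + ?fv k * torus.coef \<phi> k)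
      = (\<lambda>k. t k * torus.coef \<phi> k)"
      by (simp add: t_def algebra_simps)
    ultimately show "((\<lambda>k. t k * torus.coef \<phi> k) has_sum chem_potential \<nu> A v w \<phi>) UNIV"
      by (simp add: chem_potential_def d_def[abs_def])
  qed
  \<comment> \<open>Collects the terms already known to be summable, from \<open>v\<close> in H1 and
    from L2 pairings.\<close>
  define r where "r k = \<nu> / 2 * (?l k * (?v k)\<^sup>2) - torus.coef d k * ?fv k - A * (torus.coef d k)\<^sup>2" for k
  \<comment> \<open>The scheme multiplied by \<open>t k\<close>, where the product of
    \<open>?w k\<close> and \<open>?w k - ?v k\<close> is rewritten as half of
    \<open>(?w k)\<^sup>2 - (?v k)\<^sup>2 + (torus.coef d k)\<^sup>2\<close>. The last summand,
    being nonnegative, is discarded on summation.\<close>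
  have identity: "r k = \<nu> / 2 * (?l k * (?w k)\<^sup>2) + \<tau> * (?l k * (t k)\<^sup>2) + \<nu> / 2 * (?l k * (torus.coef d k)\<^sup>2)" for k
  proof -
    have "torus.coef d k / \<tau> = - ?l k * t k"
      using scheme_step_coef[OF step, of k] by (simp add: t_def coefd algebra_simps)
    then have "torus.coef d k = - \<tau> * ?l k * t k"
      using pos by (simp add: field_simps)
    then have "torus.coef d k * t k = - (\<tau> * (?l k * (t k)\<^sup>2))"
      by (simp add: power2_eq_square)
    then show ?thesis
      unfolding r_def t_def coefd by (simp add: algebra_simps power2_eq_square)
  qed
  obtain Sv where Sv: "((\<lambda>k. ?l k * (?v k)\<^sup>2) has_sum Sv) UNIV"
    using in_H1_has_sum[OF True sv] .
  have Sr: "(r has_sum \<nu> / 2 * Sv - (LINT x|?M. d x * ?f x) - A * (LINT x|?M. (d x)\<^sup>2)) UNIV"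
    unfolding r_def diff_conv_add_uminus
    by (intro has_sum_add has_sum_uminusI has_sum_cmult_right Sv torus.parseval torus.parseval_norm sd sf)
  have dominated: "\<exists>S. (h has_sum S) UNIV"
    if "c > 0" "\<And>k. 0 \<le> h k" "\<And>k. c * h k \<le> r k" for c and h :: "int ^ 'd \<Rightarrow> real"
  proof -
    have "(\<lambda>k. c * h k) summable_on UNIV"
      by (rule summable_on_comparison_test[of r]) (use Sr that in \<open>auto simp: summable_on_def\<close>)
    then obtain S where "((\<lambda>k. c * h k) has_sum S) UNIV"
      by (auto simp: summable_on_def)
    from has_sum_cmult_right[OF this, of "inverse c"] show ?thesis
      using \<open>c > 0\<close> by (auto simp: mult.assoc[symmetric])
  qed
  obtain Sw where Sw: "((\<lambda>k. ?l k * (?w k)\<^sup>2) has_sum Sw) UNIV"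
    using dominated[of "\<nu> / 2" "\<lambda>k. ?l k * (?w k)\<^sup>2"] pos by (auto simp: identity)
  obtain St where St: "((\<lambda>k. ?l k * (t k)\<^sup>2) has_sum St) UNIV"
    using dominated[of \<tau> "\<lambda>k. ?l k * (t k)\<^sup>2"] pos by (auto simp: identity)
  have ineq: "\<nu> / 2 * Sw + \<tau> * St \<le> \<nu> / 2 * Sv - (LINT x|?M. d x * ?f x) - A * (LINT x|?M. (d x)\<^sup>2)"
    by (rule has_sum_mono[OF has_sum_add[OF has_sum_cmult_right[OF Sw] has_sum_cmult_right[OF St]] Sr])
       (use pos in \<open>simp add: identity\<close>)
  have iF: "integrable ?M (\<lambda>x. F_pot (v x))" "integrable ?M (\<lambda>x. F_pot (w x))"
    using integrable_F_pot vm bv bw by blast+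
  have id: "integrable ?M (\<lambda>x. d x * ?f x)" "integrable ?M (\<lambda>x. (d x)\<^sup>2)"
    using square_integrable_mult[OF sd sf] sd by (auto simp: square_integrable_def)
  have "(LINT x|?M. F_pot (w x) - F_pot (v x)) \<le> (LINT x|?M. d x * ?f x + A / 2 * (d x)\<^sup>2)"
  proof (rule integral_mono_AE)
    show "AE x in ?M. F_pot (w x) - F_pot (v x) \<le> d x * ?f x + A / 2 * (d x)\<^sup>2"
      using bv bw by eventually_elim (use F_pot_increment M in \<open>auto simp: d_def\<close>)
  qed (use iF id in auto)
  then have "(LINT x|?M. F_pot (w x)) - (LINT x|?M. F_pot (v x)) \<le> (LINT x|?M. d x * ?f x) + A / 2 * (LINT x|?M. (d x)\<^sup>2)"
    using iF id by simp
  \<comment> \<open>Of the gain of \<open>A\<close> times the squared norm of \<open>d\<close>, one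
    half pays for the Taylor remainder and the other half stays on the left.\<close>
  with ineq have final: "(\<nu> / 2 * Sw + (LINT x|?M. F_pot (w x))) + A / 2 * (LINT x|?M. (d x)\<^sup>2) + \<tau> * St
      \<le> \<nu> / 2 * Sv + (LINT x|?M. F_pot (v x))"
    by simp
  have S0: "0 \<le> Sw" "0 \<le> St"
    using has_sum_nonneg[OF Sw] has_sum_nonneg[OF St] by auto
  have F0: "0 \<le> (LINT x|?M. F_pot (w x))"
    by (simp add: F_pot_def)
  have D0: "0 \<le> (LINT x|?M. (d x)\<^sup>2)"
    by simp
  have L2d: "L2_norm_sq (\<lambda>x. w x - v x) = ennreal (LINT x|?M. (d x)\<^sup>2)"
    using L2_norm_sq_real[OF sd] by (simp add: d_def[abs_def])
  have "energy \<nu> w + ennreal (A / 2) * L2_norm_sq (\<lambda>x. w x - v x)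
      + ennreal \<tau> * gradient_norm_sq (chem_potential \<nu> A v w)
     = ennreal ((\<nu> / 2 * Sw + (LINT x|?M. F_pot (w x))) + A / 2 * (LINT x|?M. (d x)\<^sup>2) + \<tau> * St)"
    unfolding energy_eq[OF pos(1) vm(2) bw Sw] gradient_norm_sq_eq[OF T St] L2d
    using pos M S0 F0 D0
    by (simp add: ennreal_mult[symmetric] ennreal_plus[symmetric] del: ennreal_plus)
  also have "\<dots> \<le> energy \<nu> v"
    unfolding energy_eq[OF pos(1) vm(1) bv Sv] using final by (rule ennreal_leI)
  finally show ?thesis .
qed

section \<open>Iteration over all time steps\<close>

theorem theorem1p2:
  fixes u :: "nat \<Rightarrow> real ^ 'd \<Rightarrow> real" and \<nu> \<tau> A :: real
  assumes "CARD('d) \<in> {1, 2, 3}"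
    and "\<nu> > 0" and "\<tau> > 0"
    and "periodic (u 0)"
    and "u 0 \<in> borel_measurable lebesgue"
    and "bounded (range (u 0))"
    and "(LINT x|lebesgue_on cell. u 0 x) = 0"
    and "\<And>n. scheme_step \<nu> \<tau> A (u n) (u (Suc n))"
    and "A \<ge> 1 + 2 * sqrt (1 + 4 / 3 * (\<nu> / \<tau>))"
    and "Linf_norm (u 0) \<le> ereal (sqrt ((A + 1) / 3))"
  shows "(\<forall>n. energy \<nu> (u (Suc n))
               + ennreal (A / 2) * L2_norm_sq (\<lambda>x. u (Suc n) x - u n x)
               + ennreal \<tau> * gradient_norm_sq (chem_potential \<nu> A (u n) (u (Suc n)))
             \<le> energy \<nu> (u n))
       \<and> (\<forall>n. energy \<nu> (u (Suc n)) \<le> energy \<nu> (u n))"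
proof -
  let ?M = "lebesgue_on (cell :: (real ^ 'd) set)"
  let ?B = "sqrt ((A + 1) / 3)"
  have "0 \<le> sqrt (1 + 4 / 3 * (\<nu> / \<tau>))" using assms(2,3) by simp
  then have A: "A \<ge> 0" using assms(9) by linarith
  then have B: "3 * ?B\<^sup>2 = A + 1" by simp
  \<comment> \<open>The maximum principle reproduces the same constant \<open>?B\<close> at each
    step, so the one-step energy estimate applies with \<open>M = ?B\<close> throughout.\<close>
  have bound: "AE x in ?M. \<bar>u n x\<bar> \<le> ?B" for n
  proof (induction n)
    case 0
    have "AE x in ?M. ereal \<bar>u 0 x\<bar> \<le> Linf_norm (u 0)"
      unfolding Linf_norm_def by (rule esssup_AE)
    then show ?case
      by eventually_elim (use assms(10) order_trans in fastforce)
  next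
    case (Suc n)
    then show ?case
      using scheme_step_max_principle[OF assms(2,3,9,8)] by blast
  qed
  have main: "energy \<nu> (u (Suc n)) + ennreal (A / 2) * L2_norm_sq (\<lambda>x. u (Suc n) x - u n x)
      + ennreal \<tau> * gradient_norm_sq (chem_potential \<nu> A (u n) (u (Suc n))) \<le> energy \<nu> (u n)" for n
    by (rule scheme_step_energy[OF assms(2,3) B A assms(8) bound bound])
  \<comment> \<open>The two further terms on the left are extended nonnegative numbers and may be
    dropped.\<close>
  moreover have "energy \<nu> (u (Suc n)) \<le> energy \<nu> (u n)" for n
    by (rule order_trans[OF _ main[of n]]) (simp add: add.assoc)
  ultimately show ?thesis by blast
qed

end
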